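(* Fix $\Lambda\ge 1$ and set $\tau=\Lambda/(\Lambda+1)$. The partially identified set for $\psi_{\mathrm T}=\mathbb E[Y(1)]$ under the marginal sensitivity model with parameter $\Lambda$ is a closed interval $[\psi_{\mathrm T}^-,\psi_{\mathrm T}^+]$. Moreover its endpoints are the optimal values of the following problems, whose minimum and maximum are attained: $$\psi_{\mathrm T}^-=\min_{\bar E\in\mathcal E_\infty(\Lambda)}\mathbb E[YZ/\bar E]\quad\text{subject to}\quad \mathbb E[Q_{1-\tau}(X,1)Z/\bar E]=\mathbb E[Q_{1-\tau}(X,1)],$$ $$\psi_{\mathrm T}^+=\max_{\bar E\in\mathcal E_\infty(\Lambda)}\mathbb E[YZ/\bar E]\quad\text{subject to}\quad \mathbb E[Q_{\tau}(X,1)Z/\bar E]=\mathbb E[Q_{\tau}(X,1)].$$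
   Context: Observed data $(X,Y,Z)\sim P$ with $X\in\mathcal X\subseteq\mathbb R^d$, $Y\in\mathbb R$, $Z\in\{0,1\}$; the nominal propensity score is $e(x)=P(Z=1\mid X=x)$, and it is assumed that $0<e(X)<1$ almost surely and $\mathbb E|Y|<\infty$. A full-data distribution $Q$ is a law of $(X,Y(0),Y(1),Z,U)$ with $U\in\mathbb R^k$ for some $k\ge1$; it is compatible with $P$ if the law of $(X,ZY(1)+(1-Z)Y(0),Z)$ under $Q$ equals $P$. $Q$ satisfies the marginal sensitivity model with parameter $\Lambda$ if under $Q$, $(Y(0),Y(1))$ is independent of $Z$ given $(X,U)$, and with $e_0(X,U)=Q(Z=1\mid X,U)$ one has $\Lambda^{-1}\le \frac{e_0(X,U)/(1-e_0(X,U))}{e(X)/(1-e(X))}\le\Lambda$ almost surely. The partially identified set for $\psi_{\mathrm T}$ is $\{\mathbb E_Q[Y(1)]: Q \text{ compatible with } P \text{ and satisfying the marginal sensitivity model with parameter }\Lambda\}$. $\mathcal E_\infty(\Lambda)$ is the set of random variables $\bar E$ defined jointly with $(X,Y,Z)$ such that $\Lambda^{-1}\le\frac{\bar E/(1-\bar E)}{e(X)/(1-e(X))}\le\Lambda$ almost surely; unsubscripted expectations are taken jointly with $(X,Y,Z)\sim P$. $F(y\mid x,z)=P(Y\le y\mid X=x,Z=z)$ and $Q_t(x,z)=\inf\{q\in\mathbb R: F(q\mid x,z)\ge t\}$.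
   Formalization: Adds the assumption E[|Y|Z/e(X)] < ∞, without which E_Q[Y(1)] is not a finite expectation for any admissible Q (E|Y| < ∞ does not imply it); Ē ranges over measurable functions of (X,Y,Z) and an independent uniform variable, which yields all joint laws. *)

theory Defs
  imports "HOL-Probability.Probability"
begin

text \<open>Observed data (X,Y,Z) with X in R^d (d = CARD('d)), Y real, Z in {0,1} encoded as bool.\<close>

definition obs_space :: "((real^'d) \<times> real \<times> bool) measure" where
  "obs_space = borel \<Otimes>\<^sub>M (borel \<Otimes>\<^sub>M count_space UNIV)"

text \<open>Full data (X, Y(0), Y(1), Z, U); U takes values in R^k, embedded in
  nat => real by zero padding of the coordinates i >= k.\<close>

definition full_space ::
  "((real^'d) \<times> real \<times> real \<times> bool \<times> (nat \<Rightarrow> real)) measure" where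
  "full_space = borel \<Otimes>\<^sub>M (borel \<Otimes>\<^sub>M (borel \<Otimes>\<^sub>M
      (count_space UNIV \<Otimes>\<^sub>M (\<Pi>\<^sub>M i\<in>UNIV. (borel :: real measure)))))"

definition fX :: "(real^'d) \<times> real \<times> real \<times> bool \<times> (nat \<Rightarrow> real) \<Rightarrow> real^'d" where
  "fX w = fst w"
definition fY0 :: "(real^'d) \<times> real \<times> real \<times> bool \<times> (nat \<Rightarrow> real) \<Rightarrow> real" where
  "fY0 w = fst (snd w)"
definition fY1 :: "(real^'d) \<times> real \<times> real \<times> bool \<times> (nat \<Rightarrow> real) \<Rightarrow> real" where
  "fY1 w = fst (snd (snd w))"
definition fZ :: "(real^'d) \<times> real \<times> real \<times> bool \<times> (nat \<Rightarrow> real) \<Rightarrow> bool" where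
  "fZ w = fst (snd (snd (snd w)))"
definition fU :: "(real^'d) \<times> real \<times> real \<times> bool \<times> (nat \<Rightarrow> real) \<Rightarrow> (nat \<Rightarrow> real)" where
  "fU w = snd (snd (snd (snd w)))"

definition observe ::
  "(real^'d) \<times> real \<times> real \<times> bool \<times> (nat \<Rightarrow> real) \<Rightarrow> (real^'d) \<times> real \<times> bool" where
  "observe w = (fX w, (if fZ w then 1 else 0) * fY1 w + (1 - (if fZ w then 1 else 0)) * fY0 w, fZ w)"

definition compatible where
  "compatible P Q \<longleftrightarrow> prob_space Q \<and> sets Q = sets full_space \<and>
     distr Q obs_space observe = P"

definition sigma_XU where
  "sigma_XU Q = vimage_algebra (space Q) (\<lambda>w. (fX w, fU w))
      (borel \<Otimes>\<^sub>M (\<Pi>\<^sub>M i\<in>UNIV. (borel :: real measure)))"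

definition cond_indep_Y_Z_given_XU where
  "cond_indep_Y_Z_given_XU Q \<longleftrightarrow>
     (\<forall>A \<in> sets (borel \<Otimes>\<^sub>M (borel :: real measure)). \<forall>B :: bool set.
        AE w in Q. real_cond_exp Q (sigma_XU Q)
              (\<lambda>w. indicator A (fY0 w, fY1 w) * indicator B (fZ w)) w
          = real_cond_exp Q (sigma_XU Q) (\<lambda>w. indicator A (fY0 w, fY1 w)) w
            * real_cond_exp Q (sigma_XU Q) (\<lambda>w. indicator B (fZ w)) w)"

definition latent_prop where
  "latent_prop Q = real_cond_exp Q (sigma_XU Q) (\<lambda>w. if fZ w then 1 else 0)"

definition odds :: "real \<Rightarrow> real" where
  "odds p = p / (1 - p)"

definition MSM where
  "MSM \<Lambda> e Q \<longleftrightarrow> cond_indep_Y_Z_given_XU Q \<and>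
     (AE w in Q. inverse \<Lambda> \<le> odds (latent_prop Q w) / odds (e (fX w)) \<and>
                 odds (latent_prop Q w) / odds (e (fX w)) \<le> \<Lambda>)"

text \<open>Partially identified set for psi_T = E_Q[Y(1)]; U in R^k for some k >= 1.\<close>
definition PI_set where
  "PI_set P e \<Lambda> = {integral\<^sup>L Q fY1 | Q. compatible P Q \<and> MSM \<Lambda> e Q \<and>
       (\<exists>k\<ge>1. AE w in Q. \<forall>i\<ge>k. fU w i = 0)}"

text \<open>Random variables E-bar defined jointly with (X,Y,Z): represented as measurable
  functions of (X,Y,Z,V) with V ~ Uniform[0,1] independent of (X,Y,Z).\<close>
definition ext_space where
  "ext_space P = P \<Otimes>\<^sub>M uniform_measure lborel {0..(1::real)}"

definition E_infty where
  "E_infty P e \<Lambda> = {Eb :: ((real^'d) \<times> real \<times> bool) \<times> real \<Rightarrow> real.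
      Eb \<in> borel_measurable (ext_space P) \<and>
      (AE \<omega> in ext_space P. inverse \<Lambda> \<le> odds (Eb \<omega>) / odds (e (fst (fst \<omega>))) \<and>
                             odds (Eb \<omega>) / odds (e (fst (fst \<omega>))) \<le> \<Lambda>)}"

definition wexp where
  "wexp P h Eb = (\<integral>\<omega>. h (fst \<omega>) * (if snd (snd (fst \<omega>)) then 1 else 0) / Eb \<omega> \<partial>ext_space P)"

definition cond_quantile :: "('x \<Rightarrow> bool \<Rightarrow> real \<Rightarrow> real) \<Rightarrow> real \<Rightarrow> 'x \<Rightarrow> bool \<Rightarrow> real" where
  "cond_quantile F t x z = Inf {q. F x z q \<ge> t}"

definition is_cdf :: "(real \<Rightarrow> real) \<Rightarrow> bool" where
  "is_cdf G \<longleftrightarrow> mono G \<and> (\<forall>y. continuous (at_right y) G) \<and>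
     (G \<longlongrightarrow> 0) at_bot \<and> (G \<longlongrightarrow> 1) at_top"

end

theory Submission
  imports Defs
begin

text \<open>The potential outcomes are generated by the quantile transform: on \<open>B\<close>, the law of \<open>X\<close> times two
  independent uniform variables \<open>V\<^sub>0, V\<^sub>1\<close>, let \<open>Y(z)\<close> be the conditional quantile of level \<open>V\<^sub>z\<close> given \<open>(X, z)\<close>. Give the treated arm density \<open>e(x)\<close> and the untreated
  arm density \<open>(1 - e(x)) r(v\<^sub>1)\<close>; the observed law is \<open>P\<close> as soon as \<open>r\<close> integrates to 1, and with \<open>U = (V\<^sub>0, V\<^sub>1)\<close> the
  odds ratio is \<open>1 / r\<close>. The two-level \<open>r\<close> that equals \<open>L\<close> above the level \<open>L / (L + 1)\<close> and \<open>1 / L\<close> below it integrates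
  to 1, and \<open>L = \<Lambda>\<close>, \<open>L = 1 / \<Lambda>\<close> give the two endpoints; convex combinations of the two weights fill the interval.

  Optimality: once the quantile \<open>q(X)\<close> is balanced, the objective is \<open>E[(Y - q(X)) Z / E] + E[q(X)]\<close>, and the first term is
  maximised pointwise by taking the extreme weight according to the sign of \<open>Y - q(X)\<close>, which is the two-level
  weight in the coordinate \<open>V\<^sub>1\<close>. The latent propensity of every admissible full-data law balances \<open>q(X)\<close>, so the same
  bound covers the partially identified set.\<close>

text \<open>The obstacle is that the conditional law of Y may have atoms. If it has one at q(X),
  levels V1 on both sides of the threshold produce the same outcome, so the two-level weight is not
  a function of (X, Y). For the full-data laws this is harmless, because U records the level. For
  the constrained problems the weight on the event Y = q(X) must be chosen anew: the centred
  objective ignores it, since Y - q(X) vanishes there, and the constraint is a single scalar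
  equation, so a one-parameter family of tie weights suffices.

  The odds bound becomes linear after inversion: 1/E = 1 + ((1 - e)/e) r, where r is the reciprocal
  of the odds ratio and ranges over [1/\<Lambda>, \<Lambda>]. The pointwise optimisation is
  therefore linear in r, and convex combinations of admissible tilts stay admissible. The same
  formula gives 1/E \<le> \<Lambda>/e, so the finite mean of |Y| Z / e(X) dominates all integrals
  that involve Y, also under a full-data law for which no moment of Y(1) is assumed.\<close>

lemma cdf_quantile_le_iff:
  fixes H :: "real \<Rightarrow> real"
  assumes H: "is_cdf H" and t: "0 < t" "t < 1"
  shows "Inf {q. t \<le> H q} \<le> y \<longleftrightarrow> t \<le> H y"
proof -
  let ?S = "{q. t \<le> H q}"
  have m: "mono H" and bot: "(H \<longlongrightarrow> 0) at_bot" and top: "(H \<longlongrightarrow> 1) at_top"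
    using H by (auto simp: is_cdf_def)
  have rc: "continuous (at_right y) H" for y
    using H by (auto simp: is_cdf_def)
  have "eventually (\<lambda>q. t < H q) at_top" using order_tendstoD(1)[OF top] t by auto
  then have ne: "?S \<noteq> {}" by (auto simp: eventually_at_top_linorder intro: less_imp_le)
  have "eventually (\<lambda>q. H q < t) at_bot" using order_tendstoD(2)[OF bot] t by auto
  then obtain b where "\<And>q. q \<le> b \<Longrightarrow> H q < t" by (auto simp: eventually_at_bot_linorder)
  then have bdd: "bdd_below ?S" by (intro bdd_belowI[of _ b]) (metis linorder_le_cases mem_Collect_eq not_le)
  have mem: "t \<le> H q" if q: "Inf ?S < q" for q
  proof -
    obtain p where "p \<in> ?S" "p < q" using cInf_lessD[OF ne q] by blast
    then show ?thesis using monoD[OF m, of p q] by auto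
  qed
  \<comment> \<open>Right-continuity puts the infimum into the set itself, so the set is a closed
    half-line. The strict bounds on \<open>t\<close> enter earlier, through the two limits of
    \<open>H\<close>, to make the set nonempty and bounded below.\<close>
  have "t \<le> H (Inf ?S)"
  proof (rule tendsto_lowerbound)
    show "(H \<longlongrightarrow> H (Inf ?S)) (at_right (Inf ?S))"
      using rc[of "Inf ?S"] by (simp add: continuous_within)
    show "\<forall>\<^sub>F x in at_right (Inf ?S). t \<le> H x"
      using mem by (auto simp: eventually_at_right_less intro!: eventually_mono[OF eventually_at_right_less])
  qed simp
  then show ?thesis
    using cInf_lower[OF _ bdd, of y] monoD[OF m, of "Inf ?S" y] by auto
qed

section \<open>The uniform law on the open unit interval\<close>

definition unif :: "real measure" where
  "unif = uniform_measure lborel {0<..<1}"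

lemma space_unif [simp]: "space unif = UNIV"
  and sets_unif [measurable_cong, simp]: "sets unif = sets borel"
  by (auto simp: unif_def)

lemma prob_space_unif: "prob_space unif"
  unfolding unif_def by (rule prob_space_uniform_measure) auto

lemma AE_unif: "AE v in unif. 0 < v \<and> v < 1"
  unfolding unif_def by (rule AE_uniform_measureI) auto

lemma emeasure_unif_le: "0 \<le> t \<Longrightarrow> t \<le> 1 \<Longrightarrow> emeasure unif {..t} = ennreal t"
proof -
  assume t: "0 \<le> t" "t \<le> 1"
  have "emeasure unif {..t} = emeasure lborel ({0<..<1} \<inter> {..t})"
    unfolding unif_def by (subst emeasure_uniform_measure) (auto simp: divide_ennreal_def)
  also have "\<dots> = ennreal t"
  proof (cases "t = 1")
    case True
    then have "{0<..<1} \<inter> {..t} = {0<..<1}" by auto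
    then show ?thesis using True by simp
  next
    case False
    then have "{0<..<1} \<inter> {..t} = {0<..t}" using t by auto
    then show ?thesis using t by simp
  qed
  finally show ?thesis .
qed

lemma measure_unif_le: "0 \<le> t \<Longrightarrow> t \<le> 1 \<Longrightarrow> measure unif {..t} = t"
  by (simp add: measure_def emeasure_unif_le)

lemma measure_unif_gt: "0 \<le> t \<Longrightarrow> t \<le> 1 \<Longrightarrow> measure unif {t<..} = 1 - t"
  using prob_space.prob_compl[OF prob_space_unif, of "{..t}"] measure_unif_le[of t]
  by (simp flip: Compl_eq_Diff_UNIV)


section \<open>Quantile transform of the observed law\<close>

text \<open>At level 0 the infimum runs over a set unbounded below, and at level 1 possibly over the
  empty set. The default value 0 makes the sublevel sets explicit at every level, as
  \<open>G_measurable\<close> requires.\<close>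

definition quantile_map :: "('x \<Rightarrow> bool \<Rightarrow> real \<Rightarrow> real) \<Rightarrow> 'x \<Rightarrow> bool \<Rightarrow> real \<Rightarrow> real" where
  "quantile_map F x z v = (if 0 < v \<and> v < 1 then cond_quantile F v x z else 0)"

locale observed_law =
  fixes P :: "((real^'d) \<times> real \<times> bool) measure"
    and e :: "real^'d \<Rightarrow> real"
    and F :: "real^'d \<Rightarrow> bool \<Rightarrow> real \<Rightarrow> real"
  assumes P_prob: "prob_space P"
    and P_sets: "sets P = sets obs_space"
    and e_meas [measurable]: "e \<in> borel_measurable borel"
    and e_version: "\<forall>A \<in> sets (borel :: (real^'d) measure).
          measure P {(x, y, z) \<in> space P. x \<in> A \<and> z}
            = (\<integral>(x, y, z). indicator A x * e x \<partial>P)"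
    and e_overlap: "AE (x, y, z) in P. 0 < e x \<and> e x < 1"
    and F_cdf: "\<forall>x z. is_cdf (F x z)"
    and F_meas: "\<forall>z q. (\<lambda>x. F x z q) \<in> borel_measurable borel"
    and F_version: "\<forall>A \<in> sets (borel :: (real^'d) measure). \<forall>z0 q.
          measure P {(x, y, z) \<in> space P. x \<in> A \<and> z = z0 \<and> y \<le> q}
            = (\<integral>(x, y, z). indicator A x * (if z = z0 then 1 else 0) * F x z0 q \<partial>P)"
    and psi_finite: "integrable P (\<lambda>(x, y, z). y * (if z then 1 else 0) / e x)"
begin

abbreviation "G \<equiv> quantile_map F"

lemma G_le_iff: "0 < v \<Longrightarrow> v < 1 \<Longrightarrow> G x z v \<le> y \<longleftrightarrow> v \<le> F x z y"
  using cdf_quantile_le_iff[of "F x z" v y] F_cdf by (simp add: quantile_map_def cond_quantile_def)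

lemma G_mono: "0 < u \<Longrightarrow> u \<le> v \<Longrightarrow> v < 1 \<Longrightarrow> G x z u \<le> G x z v"
  using G_le_iff[of u x z "G x z v"] G_le_iff[of v x z "G x z v"] by auto

lemma F_bounds: "0 \<le> F x z q" "F x z q \<le> 1"
proof -
  have m: "mono (F x z)" and bot: "(F x z \<longlongrightarrow> 0) at_bot" and top: "(F x z \<longlongrightarrow> 1) at_top"
    using F_cdf by (auto simp: is_cdf_def)
  show "0 \<le> F x z q"
    by (rule tendsto_upperbound[OF bot eventually_mono[OF eventually_le_at_bot[of q]]])
      (auto intro: monoD[OF m])
  show "F x z q \<le> 1"
    by (rule tendsto_lowerbound[OF top eventually_mono[OF eventually_ge_at_top[of q]]])
      (auto intro: monoD[OF m])
qed

lemma F_measurable [measurable]: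
  "f \<in> borel_measurable M \<Longrightarrow> (\<lambda>x. F (f x) z q) \<in> borel_measurable M"
  using F_meas measurable_compose[of f M borel "\<lambda>x. F x z q" borel] by simp

text \<open>By \<open>G_le_iff\<close> a sublevel set of the quantile is a comparison of the level
  with \<open>F\<close> at one fixed threshold, so joint measurability in point and level follows
  from measurability of \<open>F\<close> in the point alone.\<close>

lemma G_measurable [measurable]:
  assumes [measurable]: "f \<in> borel_measurable M" "g \<in> borel_measurable M"
  shows "(\<lambda>x. G (f x) z (g x)) \<in> borel_measurable M"
proof (rule borel_measurable_iff_le[THEN iffD2], intro allI)
  fix a
  have "{w \<in> space M. G (f w) z (g w) \<le> a} =
    {w \<in> space M. if 0 < g w \<and> g w < 1 then g w \<le> F (f w) z a else 0 \<le> a}"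
    using G_le_iff by (auto simp: quantile_map_def)
  also have "\<dots> \<in> sets M" by measurable
  finally show "{w \<in> space M. G (f w) z (g w) \<le> a} \<in> sets M" .
qed

definition \<mu> :: "(real^'d) measure" where "\<mu> = distr P borel fst"

definition B :: "((real^'d) \<times> real \<times> real) measure" where
  "B = \<mu> \<Otimes>\<^sub>M (unif \<Otimes>\<^sub>M unif)"

lemma sets_P [measurable_cong]: "sets P = sets (borel \<Otimes>\<^sub>M (borel \<Otimes>\<^sub>M count_space UNIV))"
  using P_sets by (simp add: obs_space_def)

lemma space_P [simp]: "space P = UNIV"
  using sets_eq_imp_space_eq[OF sets_P] by (simp add: space_pair_measure)

lemma sets_\<mu> [measurable_cong, simp]: "sets \<mu> = sets borel" and space_\<mu> [simp]: "space \<mu> = UNIV"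
  by (auto simp: \<mu>_def)

lemma sets_B [measurable_cong]: "sets B = sets (borel \<Otimes>\<^sub>M (borel \<Otimes>\<^sub>M borel))"
  unfolding B_def by (intro sets_pair_measure_cong) auto

lemma space_B [simp]: "space B = UNIV"
  by (simp add: B_def space_pair_measure)

lemma prob_space_\<mu>: "prob_space \<mu>"
  unfolding \<mu>_def by (intro prob_space.prob_space_distr P_prob) measurable

sublocale P: prob_space P by (rule P_prob)
sublocale \<mu>: prob_space \<mu> by (rule prob_space_\<mu>)
sublocale unif: prob_space unif by (rule prob_space_unif)
sublocale uu: prob_space "unif \<Otimes>\<^sub>M unif"
  by (intro prob_space_pair prob_space_unif)
sublocale B: prob_space B
  unfolding B_def by (intro prob_space_pair prob_space_unif prob_space_\<mu>)
sublocale count: sigma_finite_measure "count_space (UNIV :: bool set)"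
  by (rule sigma_finite_measure_count_space_finite) auto

lemma AE_\<mu>_overlap: "AE x in \<mu>. 0 < e x \<and> e x < 1"
  unfolding \<mu>_def by (subst AE_distr_iff) (use e_overlap in \<open>auto simp: split_beta\<close>)

lemma distr_B_fst: "distr B borel fst = \<mu>"
proof -
  have "distr B \<mu> fst = \<mu>"
    unfolding B_def by (rule uu.distr_pair_fst)
  then show ?thesis by (metis distr_cong sets_\<mu>)
qed

lemma distr_B_v1: "distr B borel (\<lambda>w. snd (snd w)) = unif"
proof (rule measure_eqI)
  fix A assume A: "A \<in> sets (distr B borel (\<lambda>w. snd (snd w)))"
  then have [measurable]: "A \<in> sets borel" by simp
  have "emeasure (distr B borel (\<lambda>w. snd (snd w))) A = emeasure B (UNIV \<times> (UNIV \<times> A))"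
    by (subst emeasure_distr) (auto intro!: arg_cong[where f="emeasure B"])
  also have "\<dots> = emeasure unif A"
    unfolding B_def
    using \<mu>.emeasure_space_1 unif.emeasure_space_1
    by (subst uu.emeasure_pair_measure_Times; simp?)
       (subst unif.emeasure_pair_measure_Times; simp)
  finally show "emeasure (distr B borel (\<lambda>w. snd (snd w))) A = emeasure unif A" .
qed simp

lemma distr_B_v0: "distr B borel (\<lambda>w. fst (snd w)) = unif"
proof (rule measure_eqI)
  fix A assume A: "A \<in> sets (distr B borel (\<lambda>w. fst (snd w)))"
  then have [measurable]: "A \<in> sets borel" by simp
  have "emeasure (distr B borel (\<lambda>w. fst (snd w))) A = emeasure B (UNIV \<times> (A \<times> UNIV))"
    by (subst emeasure_distr) (auto intro!: arg_cong[where f="emeasure B"])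
  also have "\<dots> = emeasure unif A"
    unfolding B_def
    using \<mu>.emeasure_space_1 unif.emeasure_space_1
    by (subst uu.emeasure_pair_measure_Times; simp?)
       (subst unif.emeasure_pair_measure_Times; simp)
  finally show "emeasure (distr B borel (\<lambda>w. fst (snd w))) A = emeasure unif A" .
qed simp

lemma AE_B: "AE w in B. 0 < e (fst w) \<and> e (fst w) < 1 \<and> 0 < snd (snd w) \<and> snd (snd w) < 1
   \<and> 0 < fst (snd w) \<and> fst (snd w) < 1"
proof -
  have "AE w in distr B borel fst. 0 < e w \<and> e w < 1"
    unfolding distr_B_fst by (rule AE_\<mu>_overlap)
  then have 1: "AE w in B. 0 < e (fst w) \<and> e (fst w) < 1"
    by (subst (asm) AE_distr_iff) auto
  have "AE w in distr B borel (\<lambda>w. snd (snd w)). 0 < w \<and> w < 1"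
    unfolding distr_B_v1 by (rule AE_unif)
  then have 2: "AE w in B. 0 < snd (snd w) \<and> snd (snd w) < 1"
    by (subst (asm) AE_distr_iff) auto
  have "AE w in distr B borel (\<lambda>w. fst (snd w)). 0 < w \<and> w < 1"
    unfolding distr_B_v0 by (rule AE_unif)
  then have 3: "AE w in B. 0 < fst (snd w) \<and> fst (snd w) < 1"
    by (subst (asm) AE_distr_iff) auto
  show ?thesis using 1 2 3 by eventually_elim auto
qed


section \<open>Joint laws of the latent levels and the treatment\<close>

lemma nn_integral_B:
  assumes [measurable]: "f \<in> borel_measurable (borel \<Otimes>\<^sub>M (borel \<Otimes>\<^sub>M borel))"
  shows "(\<integral>\<^sup>+w. f w \<partial>B) = (\<integral>\<^sup>+x. \<integral>\<^sup>+v0. \<integral>\<^sup>+v1. f (x, v0, v1) \<partial>unif \<partial>unif \<partial>\<mu>)"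
proof -
  have "(\<integral>\<^sup>+w. f w \<partial>B) = (\<integral>\<^sup>+x. \<integral>\<^sup>+v. f (x, v) \<partial>(unif \<Otimes>\<^sub>M unif) \<partial>\<mu>)"
    unfolding B_def by (rule uu.nn_integral_fst[symmetric]) measurable
  also have "(\<lambda>x. \<integral>\<^sup>+v. f (x, v) \<partial>(unif \<Otimes>\<^sub>M unif)) = (\<lambda>x. \<integral>\<^sup>+v0. \<integral>\<^sup>+v1. f (x, v0, v1) \<partial>unif \<partial>unif)"
    by (rule ext, rule unif.nn_integral_fst[symmetric]) measurable
  finally show ?thesis .
qed

text \<open>In the treated arm Y(1) is observed, so its level must stay uniform. In the untreated
  arm only Y(0) is observed, which is generated by the other level; tilting the law of the second
  level there by \<open>r\<close> leaves no trace in the data.\<close>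

definition D :: "(real \<Rightarrow> real) \<Rightarrow> (((real^'d) \<times> real \<times> real) \<times> bool) measure" where
  "D r = density (B \<Otimes>\<^sub>M count_space UNIV)
     (\<lambda>p. ennreal (if snd p then e (fst (fst p)) else (1 - e (fst (fst p))) * r (snd (snd (fst p)))))"

lemma sets_D [measurable_cong]:
  "sets (D r) = sets ((borel \<Otimes>\<^sub>M (borel \<Otimes>\<^sub>M borel)) \<Otimes>\<^sub>M count_space UNIV)"
  unfolding D_def by (simp, intro sets_pair_measure_cong sets_B refl)

lemma space_D [simp]: "space (D r) = UNIV"
  by (simp add: D_def space_pair_measure)

definition unit_weight :: "(real \<Rightarrow> real) \<Rightarrow> bool" where
  "unit_weight r \<longleftrightarrow> r \<in> borel_measurable borel \<and> (\<forall>v. 0 \<le> r v) \<and> (\<integral>\<^sup>+v. ennreal (r v) \<partial>unif) = 1"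

lemma unit_weightD:
  assumes "unit_weight r"
  shows "r \<in> borel_measurable borel" "0 \<le> r v" "(\<integral>\<^sup>+v. ennreal (r v) \<partial>unif) = 1"
  using assms by (auto simp: unit_weight_def)

lemma nn_integral_D:
  assumes [measurable]: "r \<in> borel_measurable borel"
    "f \<in> borel_measurable ((borel \<Otimes>\<^sub>M (borel \<Otimes>\<^sub>M borel)) \<Otimes>\<^sub>M count_space UNIV)"
  shows "(\<integral>\<^sup>+p. f p \<partial>D r) = (\<integral>\<^sup>+w. ennreal (e (fst w)) * f (w, True)
    + ennreal ((1 - e (fst w)) * r (snd (snd w))) * f (w, False) \<partial>B)"
proof -
  let ?h = "\<lambda>p. ennreal (if snd p then e (fst (fst p)) else (1 - e (fst (fst p))) * r (snd (snd (fst p))))"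
  have "(\<integral>\<^sup>+p. f p \<partial>D r) = (\<integral>\<^sup>+p. ?h p * f p \<partial>(B \<Otimes>\<^sub>M count_space UNIV))"
    unfolding D_def by (rule nn_integral_density) measurable
  also have "\<dots> = (\<integral>\<^sup>+w. \<integral>\<^sup>+z. ?h (w, z) * f (w, z) \<partial>count_space UNIV \<partial>B)"
    by (rule count.nn_integral_fst[symmetric]) measurable
  finally show ?thesis
    by (simp add: nn_integral_count_space_finite UNIV_bool add.commute)
qed

lemma nn_integral_G_le:
  "(\<integral>\<^sup>+v. indicator {..q} (G x z v) \<partial>unif) = ennreal (F x z q)"
proof -
  have "(\<integral>\<^sup>+v. indicator {..q} (G x z v) \<partial>unif) = (\<integral>\<^sup>+v. indicator {..F x z q} v \<partial>unif)"
    by (rule nn_integral_cong_AE) (use AE_unif in \<open>eventually_elim, auto simp: G_le_iff split: split_indicator\<close>)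
  then show ?thesis by (simp add: emeasure_unif_le F_bounds)
qed

section \<open>Agreement with the observed law on generating rectangles\<close>

lemma emeasure_P_Z:
  assumes [measurable]: "A \<in> sets borel"
  shows "emeasure P (A \<times> UNIV \<times> {z}) =
    (\<integral>\<^sup>+x. ennreal (if z then e x else 1 - e x) * indicator A x \<partial>\<mu>)"
proof -
  have T: "emeasure P (A \<times> UNIV \<times> {True}) = (\<integral>\<^sup>+x. ennreal (e x) * indicator A x \<partial>\<mu>)"
  proof -
    have i: "integrable \<mu> (\<lambda>x. indicator A x * e x)"
      by (rule \<mu>.integrable_const_bound[where B=1])
        (use AE_\<mu>_overlap in \<open>auto split: split_indicator\<close>)
    have "measure P (A \<times> UNIV \<times> {True}) = measure P {(x, y, z) \<in> space P. x \<in> A \<and> z}"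
      by (rule arg_cong[where f="measure P"]) auto
    also have "\<dots> = (\<integral>p. indicator A (fst p) * e (fst p) \<partial>P)"
      using e_version[rule_format, OF assms] by (simp add: split_beta')
    also have "\<dots> = (\<integral>x. indicator A x * e x \<partial>\<mu>)"
      unfolding \<mu>_def by (subst integral_distr) auto
    finally have "emeasure P (A \<times> UNIV \<times> {True}) = ennreal (\<integral>x. indicator A x * e x \<partial>\<mu>)"
      by (simp add: P.emeasure_eq_measure)
    also have "\<dots> = (\<integral>\<^sup>+x. ennreal (indicator A x * e x) \<partial>\<mu>)"
      by (rule nn_integral_eq_integral[symmetric, OF i])
        (use AE_\<mu>_overlap in \<open>auto split: split_indicator\<close>)
    also have "\<dots> = (\<integral>\<^sup>+x. ennreal (e x) * indicator A x \<partial>\<mu>)"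
      by (rule nn_integral_cong) (auto split: split_indicator)
    finally show ?thesis .
  qed
  have F: "emeasure P (A \<times> UNIV \<times> {False}) = (\<integral>\<^sup>+x. ennreal (1 - e x) * indicator A x \<partial>\<mu>)" (is "_ = ?f")
  proof -
    \<comment> \<open>The hypothesis on \<open>e\<close> gives the treated mass only. The untreated
      mass is obtained by subtraction from the law of X, and the finiteness of the treated mass
      permits the cancellation.\<close>
    let ?e = "\<integral>\<^sup>+x. ennreal (e x) * indicator A x \<partial>\<mu>"
    have "?e + emeasure P (A \<times> UNIV \<times> {False}) = emeasure P (A \<times> UNIV)"
      unfolding T[symmetric] by (subst plus_emeasure) (auto intro!: arg_cong[where f="emeasure P"])
    also have "\<dots> = emeasure \<mu> A"
      unfolding \<mu>_def by (subst emeasure_distr) (auto intro!: arg_cong[where f="emeasure P"])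
    also have "\<dots> = (\<integral>\<^sup>+x. indicator A x \<partial>\<mu>)" by simp
    also have "\<dots> = (\<integral>\<^sup>+x. ennreal (e x) * indicator A x + ennreal (1 - e x) * indicator A x \<partial>\<mu>)"
      by (rule nn_integral_cong_AE, use AE_\<mu>_overlap in eventually_elim)
        (auto split: split_indicator simp flip: ennreal_plus)
    also have "\<dots> = ?e + ?f" by (rule nn_integral_add) auto
    finally have "?e + emeasure P (A \<times> UNIV \<times> {False}) = ?e + ?f" .
    moreover have "?e \<noteq> \<infinity>" unfolding T[symmetric] by simp
    ultimately show ?thesis by (simp add: ennreal_add_left_cancel)
  qed
  show ?thesis using T F by (cases z) auto
qed

lemma Z_sets [measurable]: "{p. snd (snd p) = z} \<in> sets (borel \<Otimes>\<^sub>M (borel \<Otimes>\<^sub>M count_space UNIV))"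
proof -
  have "{p. snd (snd p) = z} = UNIV \<times> UNIV \<times> {z}" by auto
  also have "\<dots> \<in> sets (borel \<Otimes>\<^sub>M (borel \<Otimes>\<^sub>M count_space UNIV))" by measurable
  finally show ?thesis .
qed

text \<open>The hypothesis on \<open>F\<close> is an integral under \<open>P\<close> restricted to
  one arm. Here the restriction is traded for a density with respect to the law of X, the form in
  which \<open>D r\<close> is given.\<close>

lemma distr_density_Z:
  "distr (density P (indicator {p. snd (snd p) = z})) borel fst = density \<mu> (\<lambda>x. ennreal (if z then e x else 1 - e x))"
proof (rule measure_eqI)
  fix A assume "A \<in> sets (distr (density P (indicator {p. snd (snd p) = z})) borel fst)"
  then have [measurable]: "A \<in> sets borel" by simp
  have [measurable]: "fst -` A \<in> sets P"
    using measurable_sets[of fst P borel A] by simp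
  have "emeasure (distr (density P (indicator {p. snd (snd p) = z})) borel fst) A
     = (\<integral>\<^sup>+p. indicator {p. snd (snd p) = z} p * indicator (fst -` A) p \<partial>P)"
    by (subst emeasure_distr; (subst emeasure_density)?) auto
  also have "\<dots> = (\<integral>\<^sup>+p. indicator (A \<times> UNIV \<times> {z}) p \<partial>P)"
    by (rule nn_integral_cong) (auto split: split_indicator)
  also have "\<dots> = emeasure P (A \<times> UNIV \<times> {z})" by simp
  finally show "emeasure (distr (density P (indicator {p. snd (snd p) = z})) borel fst) A
      = emeasure (density \<mu> (\<lambda>x. ennreal (if z then e x else 1 - e x))) A"
    by (subst emeasure_density) (auto simp: emeasure_P_Z)
qed simp

lemma emeasure_P_rect:
  assumes [measurable]: "A \<in> sets borel"
  shows "emeasure P (A \<times> {..q} \<times> {z}) =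
    (\<integral>\<^sup>+x. ennreal (if z then e x else 1 - e x) * indicator A x * ennreal (F x z q) \<partial>\<mu>)"
proof -
  have i: "integrable P (\<lambda>p. indicator A (fst p) * indicator {p. snd (snd p) = z} p * F (fst p) z q)"
    by (rule P.integrable_const_bound[where B=1])
      (auto split: split_indicator simp: F_bounds)
  have "measure P (A \<times> {..q} \<times> {z}) = measure P {(x, y, z') \<in> space P. x \<in> A \<and> z' = z \<and> y \<le> q}"
    by (rule arg_cong[where f="measure P"]) auto
  also have "\<dots> = (\<integral>p. indicator A (fst p) * indicator {p. snd (snd p) = z} p * F (fst p) z q \<partial>P)"
    using F_version assms by (auto simp: split_beta' intro!: Bochner_Integration.integral_cong)
  finally have "emeasure P (A \<times> {..q} \<times> {z}) =
     ennreal (\<integral>p. indicator A (fst p) * indicator {p. snd (snd p) = z} p * F (fst p) z q \<partial>P)"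
    by (simp add: P.emeasure_eq_measure)
  also have "\<dots> = (\<integral>\<^sup>+p. ennreal (indicator A (fst p) * indicator {p. snd (snd p) = z} p * F (fst p) z q) \<partial>P)"
    by (rule nn_integral_eq_integral[symmetric, OF i]) (simp add: F_bounds)
  also have "\<dots> = (\<integral>\<^sup>+p. indicator {p. snd (snd p) = z} p * (indicator A (fst p) * ennreal (F (fst p) z q)) \<partial>P)"
    by (rule nn_integral_cong) (auto split: split_indicator)
  also have "\<dots> = (\<integral>\<^sup>+x. indicator A x * ennreal (F x z q) \<partial>distr (density P (indicator {p. snd (snd p) = z})) borel fst)"
    by (subst nn_integral_distr; (subst nn_integral_density)?) auto
  also have "\<dots> = (\<integral>\<^sup>+x. ennreal (if z then e x else 1 - e x) * indicator A x * ennreal (F x z q) \<partial>\<mu>)"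
    unfolding distr_density_Z by (subst nn_integral_density) (auto simp: mult.assoc)
  finally show ?thesis .
qed

definition Obs :: "((real^'d) \<times> real \<times> real) \<times> bool \<Rightarrow> (real^'d) \<times> real \<times> bool" where
  "Obs p = (fst (fst p), if snd p then G (fst (fst p)) True (snd (snd (fst p)))
      else G (fst (fst p)) False (fst (snd (fst p))), snd p)"

lemma Obs_measurable [measurable]:
  "Obs \<in> measurable ((borel \<Otimes>\<^sub>M (borel \<Otimes>\<^sub>M borel)) \<Otimes>\<^sub>M count_space UNIV) (borel \<Otimes>\<^sub>M (borel \<Otimes>\<^sub>M count_space UNIV))"
  unfolding Obs_def by measurable

lemma emeasure_D_rect:
  assumes r: "unit_weight r" and [measurable]: "A \<in> sets borel"
  shows "emeasure (distr (D r) obs_space Obs) (A \<times> {..q} \<times> {z}) =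
    (\<integral>\<^sup>+x. ennreal (if z then e x else 1 - e x) * indicator A x * ennreal (F x z q) \<partial>\<mu>)"
proof -
  note [measurable] = unit_weightD(1)[OF r]
  have [measurable]: "A \<times> {..q} \<times> {z} \<in> sets (borel \<Otimes>\<^sub>M (borel \<Otimes>\<^sub>M count_space UNIV))" by measurable
  have "emeasure (distr (D r) obs_space Obs) (A \<times> {..q} \<times> {z}) = (\<integral>\<^sup>+p. indicator (A \<times> {..q} \<times> {z}) (Obs p) \<partial>D r)"
    unfolding obs_space_def
    by (subst nn_integral_indicator[symmetric], simp, subst nn_integral_distr) auto
  also have "\<dots> = (\<integral>\<^sup>+w. ennreal (e (fst w)) * indicator (A \<times> {..q} \<times> {z}) (Obs (w, True))
    + ennreal ((1 - e (fst w)) * r (snd (snd w))) * indicator (A \<times> {..q} \<times> {z}) (Obs (w, False)) \<partial>B)"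
    by (rule nn_integral_D) measurable
  also have "\<dots> = (\<integral>\<^sup>+x. ennreal (if z then e x else 1 - e x) * indicator A x * ennreal (F x z q) \<partial>\<mu>)"
  proof (cases z)
    case True
    have "(\<integral>\<^sup>+w. ennreal (e (fst w)) * indicator (A \<times> {..q} \<times> {z}) (Obs (w, True))
       + ennreal ((1 - e (fst w)) * r (snd (snd w))) * indicator (A \<times> {..q} \<times> {z}) (Obs (w, False)) \<partial>B)
       = (\<integral>\<^sup>+w. ennreal (e (fst w)) * indicator A (fst w) * indicator {..q} (G (fst w) True (snd (snd w))) \<partial>B)"
      by (rule nn_integral_cong) (auto simp: True Obs_def split: split_indicator)
    also have "\<dots> = (\<integral>\<^sup>+x. ennreal (e x) * indicator A x * (\<integral>\<^sup>+v. indicator {..q} (G x True v) \<partial>unif) \<partial>\<mu>)"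
      by (subst nn_integral_B) (auto simp: nn_integral_cmult unif.emeasure_space_1[simplified])
    finally show ?thesis unfolding nn_integral_G_le using True by simp
  next
    case False
    have "(\<integral>\<^sup>+w. ennreal (e (fst w)) * indicator (A \<times> {..q} \<times> {z}) (Obs (w, True))
       + ennreal ((1 - e (fst w)) * r (snd (snd w))) * indicator (A \<times> {..q} \<times> {z}) (Obs (w, False)) \<partial>B)
       = (\<integral>\<^sup>+w. ennreal (1 - e (fst w)) * indicator A (fst w) * indicator {..q} (G (fst w) False (fst (snd w)))
            * ennreal (r (snd (snd w))) \<partial>B)"
      by (rule nn_integral_cong)
        (auto simp: False Obs_def ennreal_mult'' unit_weightD(2)[OF r] split: split_indicator)
    \<comment> \<open>The outcome depends on \<open>v0\<close> and the tilt on \<open>v1\<close>.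
      The two levels are independent under \<open>B\<close>, so the tilt integrates out to
      1.\<close>
    also have "\<dots> = (\<integral>\<^sup>+x. ennreal (1 - e x) * indicator A x * (\<integral>\<^sup>+v. indicator {..q} (G x False v) \<partial>unif) \<partial>\<mu>)"
      by (subst nn_integral_B) (auto simp: nn_integral_cmult unit_weightD(3)[OF r])
    finally show ?thesis unfolding nn_integral_G_le using False by simp
  qed
  finally show ?thesis .
qed

lemma prob_space_D:
  assumes r: "unit_weight r"
  shows "prob_space (D r)"
proof
  note [measurable] = unit_weightD(1)[OF r]
  have "emeasure (D r) (space (D r)) = (\<integral>\<^sup>+p. 1 \<partial>D r)" by simp
  also have "\<dots> = (\<integral>\<^sup>+w. ennreal (e (fst w)) + ennreal ((1 - e (fst w)) * r (snd (snd w))) \<partial>B)"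
    by (subst nn_integral_D) auto
  also have "\<dots> = (\<integral>\<^sup>+x. ennreal (e x) + ennreal (1 - e x) \<partial>\<mu>)"
    by (subst nn_integral_B)
      (auto simp: nn_integral_cmult nn_integral_add unit_weightD[OF r] ennreal_mult''
        unif.emeasure_space_1[simplified])
  also have "\<dots> = (\<integral>\<^sup>+x. 1 \<partial>\<mu>)"
    by (rule nn_integral_cong_AE, use AE_\<mu>_overlap in eventually_elim)
      (auto simp flip: ennreal_plus)
  finally show "emeasure (D r) (space (D r)) = 1" using \<mu>.emeasure_space_1 by simp
qed

text \<open>The hypothesis on \<open>F\<close> evaluates \<open>P\<close> exactly on these
  rectangles, hence they have to generate. The half-lines up to the natural numbers supply the
  countable exhaustion that the product of generators requires.\<close>

lemma sets_obs_space_generated: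
  "sets (obs_space :: ((real^'d) \<times> real \<times> bool) measure) =
    sigma_sets UNIV {A \<times> {..q} \<times> {z} | A q z. A \<in> sets borel}"
proof -
  have b: "sets (borel :: real measure) = sigma_sets UNIV (range atMost)"
    by (subst borel_eq_atMost) simp
  have c: "sets (count_space (UNIV :: bool set)) = sigma_sets UNIV (range (\<lambda>z. {z}))"
    unfolding sets_count_space by (rule sigma_sets_singletons[OF countable_finite[OF finite], symmetric])
  let ?E = "{a \<times> b |a b. a \<in> range atMost \<and> b \<in> range (\<lambda>z. {z})} :: (real \<times> bool) set set"
  have "sets (borel \<Otimes>\<^sub>M count_space UNIV :: (real \<times> bool) measure) =
    sets (sigma (space borel \<times> space (count_space UNIV)) ?E)"
  proof (rule sets_pair_eq[where Ca="range (\<lambda>n::nat. {..real n})" and Cb="range (\<lambda>z. {z})"])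
    show "sets (borel :: real measure) = sigma_sets (space borel) (range atMost)"
      unfolding space_borel by (rule b)
    show "sets (count_space (UNIV :: bool set)) = sigma_sets (space (count_space UNIV)) (range (\<lambda>z. {z}))"
      unfolding space_count_space by (rule c)
    show "\<Union> (range (\<lambda>n::nat. {..real n})) = space borel"
      by (auto simp: real_arch_simple)
  qed auto
  then have bc: "sets (borel \<Otimes>\<^sub>M count_space UNIV :: (real \<times> bool) measure) = sigma_sets UNIV ?E"
    by simp
  have "sets (obs_space :: ((real^'d) \<times> real \<times> bool) measure) =
    sets (sigma (space borel \<times> space (borel \<Otimes>\<^sub>M count_space UNIV)) {a \<times> b |a b. a \<in> sets borel \<and> b \<in> ?E})"
    unfolding obs_space_def
  proof (rule sets_pair_eq[where Ca="{UNIV}" and Cb="range (\<lambda>(n::nat, z). {..real n} \<times> {z})"])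
    show "sets borel = sigma_sets (space borel) (sets borel :: (real^'d) set set)"
      by (metis sets.sigma_sets_eq)
    show "sets (borel \<Otimes>\<^sub>M count_space UNIV) = sigma_sets (space (borel \<Otimes>\<^sub>M count_space UNIV)) ?E"
      unfolding bc by (simp add: space_pair_measure)
    show "\<Union> (range (\<lambda>(n::nat, z). {..real n} \<times> {z})) = space (borel \<Otimes>\<^sub>M count_space UNIV :: (real \<times> bool) measure)"
    proof -
      have "p \<in> \<Union> (range (\<lambda>(n::nat, z). {..real n} \<times> {z}))" for p :: "real \<times> bool"
      proof -
        obtain n where "fst p \<le> real n" using real_arch_simple by blast
        then show ?thesis by (intro UN_I[of "(n, snd p)"]) (auto simp: mem_Times_iff)
      qed
      then show ?thesis by (auto simp: space_pair_measure)
    qed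
    show "countable (range (\<lambda>(n::nat, z::bool). {..real n} \<times> {z}))" by simp
    show "range (\<lambda>(n::nat, z). {..real n} \<times> {z}) \<subseteq> ?E" by auto
    show "?E \<subseteq> Pow (space (borel \<Otimes>\<^sub>M count_space UNIV))" by (simp add: space_pair_measure)
    show "\<Union>{UNIV} = space borel" by simp
  qed simp_all
  also have "\<dots> = sigma_sets UNIV {a \<times> b |a b. a \<in> sets borel \<and> b \<in> ?E}"
    by (simp add: space_pair_measure)
  also have "{a \<times> b |a b. a \<in> sets borel \<and> b \<in> ?E} = ({A \<times> {..q} \<times> {z} | A q z. A \<in> sets borel} :: ((real^'d) \<times> real \<times> bool) set set)"
    by blast
  finally show ?thesis .
qed

text \<open>The values on the generating rectangles do not involve \<open>r\<close>: every tilt of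
  the unobserved Y(1) is compatible with the data. This is the source of the
  nonidentification.\<close>

lemma distr_D_Obs:
  assumes r: "unit_weight r"
  shows "distr (D r) obs_space Obs = P"
proof -
  define E where "E = ({A \<times> {..q} \<times> {z} | A q z. A \<in> sets borel} :: ((real^'d) \<times> real \<times> bool) set set)"
  define C where "C = (range (\<lambda>(n::nat, z). UNIV \<times> {..real n} \<times> {z}) :: ((real^'d) \<times> real \<times> bool) set set)"
  have C_sub: "C \<subseteq> E"
  proof
    fix a assume "a \<in> C"
    then obtain n :: nat and z where "a = UNIV \<times> {..real n} \<times> {z}" by (auto simp: C_def)
    moreover have "(UNIV :: (real^'d) set) \<in> sets borel" by simp
    ultimately show "a \<in> E" unfolding E_def by blast
  qed
  have eq: "emeasure (distr (D r) obs_space Obs) a = emeasure P a" if a: "a \<in> E" for a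
  proof -
    obtain A q z where "a = A \<times> {..q} \<times> {z}" "A \<in> sets borel" using a unfolding E_def by blast
    then show ?thesis using emeasure_D_rect[OF r, of A q z] emeasure_P_rect[of A q z] by simp
  qed
  have int: "a \<inter> b \<in> E" if ab: "a \<in> E" "b \<in> E" for a b
  proof -
    obtain A q z A' q' z' where *: "a = A \<times> {..q} \<times> {z}" "b = A' \<times> {..q'} \<times> {z'}"
      "A \<in> sets borel" "A' \<in> sets borel" using ab unfolding E_def by blast
    show "a \<inter> b \<in> E"
    proof (cases "z = z'")
      case True
      then have "a \<inter> b = (A \<inter> A') \<times> {..min q q'} \<times> {z}" using * by auto
      then show ?thesis using * sets.Int[of A borel A'] unfolding E_def by blast
    next
      case False
      \<comment> \<open>Rectangles over different arms are disjoint; allowing an empty base set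
        keeps their intersection in the generator.\<close>
      then have "a \<inter> b = {} \<times> {..q} \<times> {z}" using * by auto
      then show ?thesis using sets.empty_sets[of borel] unfolding E_def by blast
    qed
  qed
  have gen: "sets P = sigma_sets UNIV E"
    unfolding P_sets E_def by (rule sets_obs_space_generated)
  show ?thesis
  proof (rule measure_eqI_generator_eq_countable[where \<Omega>=UNIV and E=E and A=C])
    show "Int_stable E" using int by (simp add: Int_stable_def)
    show "sets (distr (D r) obs_space Obs) = sigma_sets UNIV E"
      unfolding sets_distr P_sets[symmetric] by (rule gen)
    show "\<Union>C = UNIV"
    proof -
      have "p \<in> \<Union>C" for p :: "(real^'d) \<times> real \<times> bool"
      proof -
        obtain n where "fst (snd p) \<le> real n" using real_arch_simple by blast
        then show ?thesis unfolding C_def by (intro UN_I[of "(n, snd (snd p))"]) (auto simp: mem_Times_iff)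
      qed
      then show ?thesis by auto
    qed
    show "countable C" by (simp add: C_def)
    show "emeasure (distr (D r) obs_space Obs) a \<noteq> \<infinity>" if "a \<in> C" for a
      using that C_sub by (subst eq) auto
  qed (fact C_sub eq gen | simp)+
qed

end

text \<open>The threshold is forced: for L \<noteq> 1 the equation L (1 - t) + t / L = 1 has the
  single solution t = L / (L + 1). Replacing L by 1 / L exchanges the two values and moves the
  threshold to 1 / (L + 1).\<close>

definition two_level :: "real \<Rightarrow> real \<Rightarrow> real" where
  "two_level L v = (if v > L / (L + 1) then L else 1 / L)"

lemma two_level_measurable [measurable]: "two_level L \<in> borel_measurable borel"
  unfolding two_level_def by measurable

section \<open>Unit weights and the densities they induce on the latent levels\<close>

context observed_law begin

lemma unit_weight_two_level: assumes "0 < L" shows "unit_weight (two_level L)"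
  unfolding unit_weight_def
proof (intro conjI allI)
  let ?t = "L / (L + 1)"
  have t: "0 \<le> ?t" "?t \<le> 1" using assms by auto
  have "(\<integral>\<^sup>+v. ennreal (two_level L v) \<partial>unif) =
    (\<integral>\<^sup>+v. ennreal L * indicator {?t<..} v + ennreal (1 / L) * indicator {..?t} v \<partial>unif)"
    by (rule nn_integral_cong) (auto simp: two_level_def split: split_indicator)
  also have "\<dots> = ennreal L * ennreal (1 - ?t) + ennreal (1 / L) * ennreal ?t"
    using t by (simp add: nn_integral_add nn_integral_cmult emeasure_unif_le
        unif.emeasure_eq_measure measure_unif_gt measure_unif_le)
  also have "\<dots> = ennreal (L * (1 - ?t) + 1 / L * ?t)"
    using assms t by (simp flip: ennreal_mult ennreal_plus)
  also have "L * (1 - ?t) + 1 / L * ?t = 1" using assms by (simp add: field_simps)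
  finally show "(\<integral>\<^sup>+v. ennreal (two_level L v) \<partial>unif) = 1" by simp
  show "0 \<le> two_level L v" for v using assms by (simp add: two_level_def)
qed measurable

lemma unit_weight_convex:
  assumes r: "unit_weight r" "unit_weight r'" and s: "0 \<le> s" "s \<le> 1"
  shows "unit_weight (\<lambda>v. (1 - s) * r v + s * r' v)"
  unfolding unit_weight_def
proof (intro conjI allI)
  note [measurable] = r[THEN unit_weightD(1)] and nn = r[THEN unit_weightD(2)]
  have "(\<integral>\<^sup>+v. ennreal ((1 - s) * r v + s * r' v) \<partial>unif) =
     (\<integral>\<^sup>+v. ennreal (1 - s) * ennreal (r v) + ennreal s * ennreal (r' v) \<partial>unif)"
    using s nn by (simp flip: ennreal_mult)
  also have "\<dots> = ennreal (1 - s) + ennreal s"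
    by (simp add: nn_integral_add nn_integral_cmult r[THEN unit_weightD(3)])
  also have "\<dots> = 1" using s by (simp flip: ennreal_plus)
  finally show "(\<integral>\<^sup>+v. ennreal ((1 - s) * r v + s * r' v) \<partial>unif) = 1" .
  show "0 \<le> (1 - s) * r v + s * r' v" for v using s nn by simp
  show "(\<lambda>v. (1 - s) * r v + s * r' v) \<in> borel_measurable borel" by measurable
qed

lemma unit_weight_1: "unit_weight (\<lambda>_. 1)"
  using unif.emeasure_space_1 by (simp add: unit_weight_def)

text \<open>This is the density, relative to \<open>B\<close>, of the law of X and the two levels
  under \<open>D r\<close>, obtained by adding the two arms.\<close>

definition weight :: "(real \<Rightarrow> real) \<Rightarrow> (real^'d) \<times> real \<times> real \<Rightarrow> real" where
  "weight r w = e (fst w) + (1 - e (fst w)) * r (snd (snd w))"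

lemma weight_measurable [measurable]:
  assumes [measurable]: "r \<in> borel_measurable borel"
  shows "weight r \<in> borel_measurable (borel \<Otimes>\<^sub>M (borel \<Otimes>\<^sub>M borel))"
  unfolding weight_def by measurable

lemma AE_weight_pos: "unit_weight r \<Longrightarrow> AE w in B. 0 \<le> weight r w"
  using AE_B by eventually_elim (auto simp: weight_def unit_weightD)

lemma distr_D_fst:
  assumes r: "unit_weight r"
  shows "distr (D r) B fst = density B (\<lambda>w. ennreal (weight r w))"
proof (rule measure_eqI)
  note [measurable] = unit_weightD(1)[OF r]
  fix A assume "A \<in> sets (distr (D r) B fst)"
  then have [measurable]: "A \<in> sets (borel \<Otimes>\<^sub>M (borel \<Otimes>\<^sub>M borel))" by (simp add: sets_B)
  have "emeasure (distr (D r) B fst) A = (\<integral>\<^sup>+p. indicator A (fst p) \<partial>D r)"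
    by (subst nn_integral_indicator[symmetric], simp add: sets_B, subst nn_integral_distr) auto
  also have "\<dots> = (\<integral>\<^sup>+w. ennreal (weight r w) * indicator A w \<partial>B)"
  proof -
    have "(\<integral>\<^sup>+p. indicator A (fst p) \<partial>D r) = (\<integral>\<^sup>+w. ennreal (e (fst w)) * indicator A w
       + ennreal ((1 - e (fst w)) * r (snd (snd w))) * indicator A w \<partial>B)"
      by (subst nn_integral_D) auto
    also have "\<dots> = (\<integral>\<^sup>+w. ennreal (weight r w) * indicator A w \<partial>B)"
      by (rule nn_integral_cong_AE, use AE_B in eventually_elim)
        (auto simp: weight_def unit_weightD(2)[OF r] split: split_indicator)
    finally show ?thesis .
  qed
  also have "\<dots> = emeasure (density B (\<lambda>w. ennreal (weight r w))) A"
    by (subst emeasure_density) auto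
  finally show "emeasure (distr (D r) B fst) A = emeasure (density B (\<lambda>w. ennreal (weight r w))) A" .
qed simp

text \<open>The tilt sits in the untreated arm, so the treated part is the same for every
  \<open>r\<close>.\<close>

lemma distr_D_fst_treated:
  assumes r: "unit_weight r"
  shows "distr (density (D r) (\<lambda>p. if snd p then 1 else 0)) B fst = density B (\<lambda>w. ennreal (e (fst w)))"
proof (rule measure_eqI)
  note [measurable] = unit_weightD(1)[OF r]
  fix A assume "A \<in> sets (distr (density (D r) (\<lambda>p. if snd p then 1 else 0)) B fst)"
  then have [measurable]: "A \<in> sets (borel \<Otimes>\<^sub>M (borel \<Otimes>\<^sub>M borel))" by (simp add: sets_B)
  have "emeasure (distr (density (D r) (\<lambda>p. if snd p then 1 else 0)) B fst) A
      = (\<integral>\<^sup>+p. (if snd p then 1 else 0) * indicator A (fst p) \<partial>D r)"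
    by (subst nn_integral_indicator[symmetric], simp add: sets_B, subst nn_integral_distr; (subst nn_integral_density)?) auto
  also have "\<dots> = (\<integral>\<^sup>+w. ennreal (e (fst w)) * indicator A w \<partial>B)"
    by (subst nn_integral_D) auto
  also have "\<dots> = emeasure (density B (\<lambda>w. ennreal (e (fst w)))) A"
    by (subst emeasure_density) auto
  finally show "emeasure (distr (density (D r) (\<lambda>p. if snd p then 1 else 0)) B fst) A
    = emeasure (density B (\<lambda>w. ennreal (e (fst w)))) A" .
qed simp

lemma D_integral:
  fixes f :: "(real^'d) \<times> real \<times> real \<Rightarrow> real"
  assumes r: "unit_weight r" and f [measurable]: "f \<in> borel_measurable (borel \<Otimes>\<^sub>M (borel \<Otimes>\<^sub>M borel))"
  shows "(\<integral>p. f (fst p) \<partial>D r) = (\<integral>w. weight r w * f w \<partial>B)"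
proof -
  note [measurable] = unit_weightD(1)[OF r]
  have "(\<integral>p. f (fst p) \<partial>D r) = (\<integral>w. f w \<partial>distr (D r) B fst)"
    by (subst integral_distr) auto
  also have "\<dots> = (\<integral>w. weight r w * f w \<partial>B)"
    unfolding distr_D_fst[OF r] by (subst integral_density) (use AE_weight_pos[OF r] in auto)
  finally show ?thesis .
qed

lemma D_integral_treated:
  fixes f :: "(real^'d) \<times> real \<times> real \<Rightarrow> real"
  assumes r: "unit_weight r" and f [measurable]: "f \<in> borel_measurable (borel \<Otimes>\<^sub>M (borel \<Otimes>\<^sub>M borel))"
  shows "(\<integral>p. (if snd p then 1 else 0) * f (fst p) \<partial>D r) = (\<integral>w. e (fst w) * f w \<partial>B)"
    and "integrable (D r) (\<lambda>p. (if snd p then 1 else 0) * f (fst p)) \<longleftrightarrow> integrable B (\<lambda>w. e (fst w) * f w)"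
proof -
  note [measurable] = unit_weightD(1)[OF r]
  let ?Z = "\<lambda>p. if snd p then 1 else (0::real)"
  have pos: "AE w in B. 0 \<le> e (fst w)" using AE_B by eventually_elim auto
  have Z: "density (D r) (\<lambda>p. if snd p then 1 else 0) = density (D r) (\<lambda>p. ennreal (?Z p))"
    by (rule arg_cong[where f="density _"]) auto
  have "(\<integral>p. ?Z p * f (fst p) \<partial>D r) = (\<integral>p. f (fst p) \<partial>density (D r) (\<lambda>p. ennreal (?Z p)))"
    by (subst integral_density) auto
  also have "\<dots> = (\<integral>w. f w \<partial>distr (density (D r) (\<lambda>p. ennreal (?Z p))) B fst)"
    by (subst integral_distr) auto
  also have "\<dots> = (\<integral>w. e (fst w) * f w \<partial>B)"
    unfolding distr_D_fst_treated[OF r, unfolded Z] by (subst integral_density) (use pos in auto)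
  finally show "(\<integral>p. ?Z p * f (fst p) \<partial>D r) = (\<integral>w. e (fst w) * f w \<partial>B)" .
  have "integrable (D r) (\<lambda>p. ?Z p * f (fst p)) \<longleftrightarrow> integrable (density (D r) (\<lambda>p. ennreal (?Z p))) (\<lambda>p. f (fst p))"
    by (subst integrable_density) auto
  also have "\<dots> \<longleftrightarrow> integrable (distr (density (D r) (\<lambda>p. ennreal (?Z p))) B fst) f"
    by (subst integrable_distr_eq) auto
  also have "\<dots> \<longleftrightarrow> integrable B (\<lambda>w. e (fst w) * f w)"
    unfolding distr_D_fst_treated[OF r, unfolded Z] by (subst integrable_density) (use pos in auto)
  finally show "integrable (D r) (\<lambda>p. ?Z p * f (fst p)) \<longleftrightarrow> integrable B (\<lambda>w. e (fst w) * f w)" .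
qed

section \<open>Transfer of means and integrability between the observed data and the latent
  levels\<close>

definition y1 :: "(real^'d) \<times> real \<times> real \<Rightarrow> real" where
  "y1 w = G (fst w) True (snd (snd w))"

lemma y1_measurable [measurable]: "y1 \<in> borel_measurable (borel \<Otimes>\<^sub>M (borel \<Otimes>\<^sub>M borel))"
  unfolding y1_def by measurable

text \<open>Every unit weight represents \<open>P\<close> and the treated arm does not see which one
  is taken; the constant weight 1 is the simplest choice.\<close>

lemma P_integral_treated:
  fixes f :: "(real^'d) \<times> real \<Rightarrow> real"
  assumes f [measurable]: "f \<in> borel_measurable (borel \<Otimes>\<^sub>M borel)"
  shows "(\<integral>p. (if snd (snd p) then 1 else 0) * f (fst p, fst (snd p)) \<partial>P) = (\<integral>w. e (fst w) * f (fst w, y1 w) \<partial>B)"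
    and "integrable P (\<lambda>p. (if snd (snd p) then 1 else 0) * f (fst p, fst (snd p))) \<longleftrightarrow>
      integrable B (\<lambda>w. e (fst w) * f (fst w, y1 w))"
proof -
  let ?f = "\<lambda>p. (if snd (snd p) then 1 else 0) * f (fst p, fst (snd p))"
  have *: "(\<lambda>p. ?f (Obs p)) = (\<lambda>p. (if snd p then 1 else 0) * f (fst (fst p), y1 (fst p)))"
    by (auto simp: Obs_def y1_def)
  have "(\<integral>p. ?f p \<partial>distr (D (\<lambda>_. 1)) obs_space Obs) = (\<integral>p. ?f (Obs p) \<partial>D (\<lambda>_. 1))"
    unfolding obs_space_def by (rule integral_distr) measurable
  also have "\<dots> = (\<integral>w. e (fst w) * f (fst w, y1 w) \<partial>B)"
    unfolding * by (rule D_integral_treated[OF unit_weight_1]) measurable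
  finally show "(\<integral>p. ?f p \<partial>P) = (\<integral>w. e (fst w) * f (fst w, y1 w) \<partial>B)"
    unfolding distr_D_Obs[OF unit_weight_1] .
  have "integrable (distr (D (\<lambda>_. 1)) obs_space Obs) ?f \<longleftrightarrow> integrable (D (\<lambda>_. 1)) (\<lambda>p. ?f (Obs p))"
    unfolding obs_space_def by (rule integrable_distr_eq) measurable
  also have "\<dots> \<longleftrightarrow> integrable B (\<lambda>w. e (fst w) * f (fst w, y1 w))"
    unfolding * by (rule D_integral_treated[OF unit_weight_1]) measurable
  finally show "integrable P ?f \<longleftrightarrow> integrable B (\<lambda>w. e (fst w) * f (fst w, y1 w))"
    unfolding distr_D_Obs[OF unit_weight_1] .
qed

text \<open>The density \<open>e\<close> of the treated arm cancels the division by \<open>e\<close>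
  in \<open>psi_finite\<close>.\<close>

lemma integrable_y1: "integrable B y1"
proof -
  have "integrable P (\<lambda>p. (if snd (snd p) then 1 else 0) * (fst (snd p) / e (fst p)))"
    using psi_finite by (simp add: split_beta' mult.commute)
  then have "integrable B (\<lambda>w. e (fst w) * (y1 w / e (fst w)))"
    using P_integral_treated(2)[of "\<lambda>p. snd p / e (fst p)"] by simp
  then show ?thesis
    by (rule integrable_cong_AE_imp) (measurable, use AE_B in \<open>eventually_elim, auto\<close>)
qed

lemma fst_\<mu>:
  fixes f :: "real^'d \<Rightarrow> real"
  assumes [measurable]: "f \<in> borel_measurable borel"
  shows "integrable B (\<lambda>w. f (fst w)) \<longleftrightarrow> integrable \<mu> f"
    "integrable P (\<lambda>w. f (fst w)) \<longleftrightarrow> integrable \<mu> f"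
    "(\<integral>w. f (fst w) \<partial>B) = (\<integral>x. f x \<partial>\<mu>)"
    "(\<integral>w. f (fst w) \<partial>P) = (\<integral>x. f x \<partial>\<mu>)"
proof -
  have B: "fst \<in> measurable B borel" and P: "fst \<in> measurable P borel" by measurable
  show "integrable B (\<lambda>w. f (fst w)) \<longleftrightarrow> integrable \<mu> f"
    using integrable_distr_eq[OF B assms] unfolding distr_B_fst by simp
  show "integrable P (\<lambda>w. f (fst w)) \<longleftrightarrow> integrable \<mu> f"
    unfolding \<mu>_def using integrable_distr_eq[OF P assms] by simp
  show "(\<integral>w. f (fst w) \<partial>B) = (\<integral>x. f x \<partial>\<mu>)"
    using integral_distr[OF B assms] unfolding distr_B_fst by simp
  show "(\<integral>w. f (fst w) \<partial>P) = (\<integral>x. f x \<partial>\<mu>)"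
    unfolding \<mu>_def using integral_distr[OF P assms] by simp
qed

text \<open>Where the quantile at \<open>t\<close> is nonnegative, \<open>y1\<close> dominates it in
  absolute value at all levels above \<open>t\<close>; where it is negative, at all levels up to
  \<open>t\<close>. Either range of levels has mass at least \<open>min t (1 - t)\<close>, so the
  mean absolute value of \<open>y1\<close> bounds that of the quantile up to this factor.\<close>

lemma integrable_quantile:
  assumes t: "0 < t" "t < 1"
  shows "integrable \<mu> (\<lambda>x. G x True t)"
proof (rule integrableI_bounded)
  let ?q = "\<lambda>x. G x True t"
  let ?m = "min t (1 - t)"
  define S where "S x = (if 0 \<le> ?q x then {t<..} else {..t})" for x
  have S: "ennreal ?m \<le> emeasure unif (S x)" for x
    using t by (auto simp: S_def unif.emeasure_eq_measure measure_unif_le measure_unif_gt)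
  have [measurable]: "(\<lambda>w. indicator (S (fst w)) (snd (snd w)) :: ennreal)
    \<in> borel_measurable (borel \<Otimes>\<^sub>M (borel \<Otimes>\<^sub>M borel :: (real \<times> real) measure))"
  proof -
    have *: "(\<lambda>w. indicator (S (fst w)) (snd (snd w)) :: ennreal) =
      (\<lambda>w. if 0 \<le> ?q (fst w) then indicator {t<..} (snd (snd w)) else indicator {..t} (snd (snd w)))"
      by (auto simp: S_def)
    show ?thesis unfolding * by measurable
  qed
  have "ennreal ?m * (\<integral>\<^sup>+x. ennreal (norm (?q x)) \<partial>\<mu>) = (\<integral>\<^sup>+x. ennreal \<bar>?q x\<bar> * ennreal ?m \<partial>\<mu>)"
    by (subst nn_integral_cmult[symmetric]) (auto simp: mult.commute)
  also have "\<dots> \<le> (\<integral>\<^sup>+x. ennreal \<bar>?q x\<bar> * emeasure unif (S x) \<partial>\<mu>)"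
    by (intro nn_integral_mono mult_left_mono S) auto
  also have "\<dots> = (\<integral>\<^sup>+x. \<integral>\<^sup>+v0. \<integral>\<^sup>+v1. ennreal \<bar>?q x\<bar> * indicator (S x) v1 \<partial>unif \<partial>unif \<partial>\<mu>)"
    by (simp add: nn_integral_cmult unif.emeasure_space_1[simplified] S_def)
  also have "\<dots> = (\<integral>\<^sup>+w. ennreal \<bar>?q (fst w)\<bar> * indicator (S (fst w)) (snd (snd w)) \<partial>B)"
    by (subst nn_integral_B) simp_all
  also have "\<dots> \<le> (\<integral>\<^sup>+w. ennreal (norm (y1 w)) \<partial>B)"
  proof (rule nn_integral_mono_AE, use AE_B in eventually_elim)
    fix w :: "(real^'d) \<times> real \<times> real"
    assume w: "0 < e (fst w) \<and> e (fst w) < 1 \<and> 0 < snd (snd w) \<and> snd (snd w) < 1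
      \<and> 0 < fst (snd w) \<and> fst (snd w) < 1"
    show "ennreal \<bar>?q (fst w)\<bar> * indicator (S (fst w)) (snd (snd w)) \<le> ennreal (norm (y1 w))"
      using G_mono[of t "snd (snd w)" "fst w" True] G_mono[of "snd (snd w)" t "fst w" True] w t
      by (auto simp: S_def y1_def split: split_indicator if_splits intro!: ennreal_leI)
  qed
  also have "\<dots> < \<infinity>" using integrable_y1 by (simp add: integrable_iff_bounded)
  finally have "ennreal ?m * (\<integral>\<^sup>+x. ennreal (norm (?q x)) \<partial>\<mu>) < \<infinity>" .
  moreover have "ennreal ?m \<noteq> 0" using t by auto
  ultimately show "(\<integral>\<^sup>+x. ennreal (norm (?q x)) \<partial>\<mu>) < \<infinity>"
    by (auto simp: ennreal_mult_less_top)
qed measurable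

text \<open>X is part of the observation, so its law under \<open>D r\<close> is the one under
  \<open>P\<close>. Hence every unit weight balances every function of X, in particular the
  quantile.\<close>

lemma integral_weight:
  fixes f :: "real^'d \<Rightarrow> real"
  assumes r: "unit_weight r" and [measurable]: "f \<in> borel_measurable borel"
  shows "(\<integral>w. weight r w * f (fst w) \<partial>B) = (\<integral>x. f x \<partial>\<mu>)"
proof -
  note [measurable] = unit_weightD(1)[OF r]
  have "(\<integral>w. weight r w * f (fst w) \<partial>B) = (\<integral>p. f (fst (fst p)) \<partial>D r)"
    by (rule D_integral[OF r, symmetric]) measurable
  also have "\<dots> = (\<integral>p. f (fst (Obs p)) \<partial>D r)" by (simp add: Obs_def)
  also have "\<dots> = (\<integral>p. f (fst p) \<partial>distr (D r) obs_space Obs)"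
    unfolding obs_space_def by (subst integral_distr) auto
  also have "\<dots> = (\<integral>x. f x \<partial>\<mu>)"
    unfolding distr_D_Obs[OF r] by (rule fst_\<mu>) measurable
  finally show ?thesis .
qed

lemma integrable_weight:
  assumes r: "r \<in> borel_measurable borel" "\<And>v. \<bar>r v\<bar> \<le> C" and f: "integrable B f"
  shows "integrable B (\<lambda>w. weight r w * f w)"
proof (rule Bochner_Integration.integrable_bound)
  note [measurable] = r(1)
  show "integrable B (\<lambda>w. (1 + C) * f w)" using f by simp
  show "(\<lambda>w. weight r w * f w) \<in> borel_measurable B" using f by measurable
  show "AE w in B. norm (weight r w * f w) \<le> norm ((1 + C) * f w)"
    using AE_B
  proof eventually_elim
    fix w :: "(real^'d) \<times> real \<times> real"
    assume w: "0 < e (fst w) \<and> e (fst w) < 1 \<and> 0 < snd (snd w) \<and> snd (snd w) < 1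
      \<and> 0 < fst (snd w) \<and> fst (snd w) < 1"
    have "\<bar>weight r w\<bar> \<le> \<bar>e (fst w)\<bar> + \<bar>1 - e (fst w)\<bar> * \<bar>r (snd (snd w))\<bar>"
      unfolding weight_def by (metis abs_mult abs_triangle_ineq)
    also have "\<dots> \<le> 1 + 1 * C"
      using w by (intro add_mono mult_mono r(2)) auto
    finally show "norm (weight r w * f w) \<le> norm ((1 + C) * f w)"
      by (auto simp: abs_mult intro!: mult_right_mono)
  qed
qed

end

section \<open>Pointwise bounds\<close>

text \<open>Here \<open>r\<close> is the reciprocal of the odds ratio, and the interval from
  1/\<Lambda> to \<Lambda> is closed under reciprocals. The positive lower bound confines
  \<open>p\<close> to the open unit interval: the odds are negative outside the closed one, zero at
  0, and also zero at 1 because division by zero yields zero.\<close>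

lemma odds_ratio_bound:
  assumes e: "0 < e" "e < 1" and \<Lambda>: "1 \<le> \<Lambda>"
    and b: "inverse \<Lambda> \<le> odds p / odds e" "odds p / odds e \<le> \<Lambda>"
  obtains r where "1 / \<Lambda> \<le> r" "r \<le> \<Lambda>" "1 / p = 1 + (1 - e) / e * r" "0 < p" "p < 1"
proof -
  have oe: "0 < odds e" using e by (simp add: odds_def)
  have "0 < inverse \<Lambda>" using \<Lambda> by simp
  then have "0 < odds p / odds e" using b(1) by linarith
  then have op: "0 < odds p" using oe by (simp add: zero_less_divide_iff)
  then have p: "0 < p" "p < 1" by (auto simp: odds_def zero_less_divide_iff)
  define c where "c = odds p / odds e"
  have c: "0 < c" "inverse \<Lambda> \<le> c" "c \<le> \<Lambda>" using op oe b by (simp_all add: c_def)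
  have "1 / \<Lambda> \<le> 1 / c" "1 / c \<le> \<Lambda>"
    using c \<Lambda> le_imp_inverse_le[of "inverse \<Lambda>" c] by (simp_all add: inverse_eq_divide frac_le)
  moreover have "1 / p = 1 + (1 - e) / e * (1 / c)"
  proof -
    have "(1 - e) / e * (1 / c) = (1 - p) / p"
      using p e by (simp add: c_def odds_def)
    then show ?thesis using p by (simp add: diff_divide_distrib)
  qed
  ultimately show thesis using that p by blast
qed

lemma odds_ratio_eq:
  assumes e: "0 < e" "e < 1" and r: "0 < r"
  shows "odds (1 / (1 + (1 - e) / e * r)) / odds e = 1 / r"
proof -
  have "0 < e + r - e * r" using e r by (smt (verit) mult_less_cancel_right1)
  moreover have "1 / (1 + (1 - e) / e * r) = e / (e + r - e * r)"
    using e by (simp add: field_simps)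
  moreover have "1 - e / (e + r - e * r) = (1 - e) * r / (e + r - e * r)"
    using calculation(1) by (simp add: field_simps)
  ultimately show ?thesis using e r by (simp add: odds_def)
qed

section \<open>Extremal inverse weights in terms of the observed outcome\<close>

locale marginal_sensitivity = observed_law P e F for P e F +
  fixes \<Lambda> :: real
  assumes Lambda_ge: "1 \<le> \<Lambda>"
begin

definition q :: "real \<Rightarrow> real^'a \<Rightarrow> real" where
  "q L x = G x True (L / (L + 1))"

lemma q_measurable [measurable]: "q L \<in> borel_measurable borel"
  unfolding q_def by measurable

definition \<psi> :: "real \<Rightarrow> real" where
  "\<psi> L = (\<integral>w. weight (two_level L) w * y1 w \<partial>B)"

lemma inverse_Lambda_le: "1 / \<Lambda> \<le> \<Lambda>"
proof -
  have "1 / \<Lambda> \<le> 1" using Lambda_ge by simp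
  then show ?thesis using Lambda_ge by linarith
qed

text \<open>The upper bound is the case \<open>\<sigma> = 1\<close>, \<open>L = \<Lambda>\<close>, the lower one is \<open>\<sigma> = -1\<close>, \<open>L = 1 / \<Lambda>\<close>;
  the quantile level is \<open>L / (L + 1)\<close> in both cases.\<close>
definition extremal :: "real \<Rightarrow> real \<Rightarrow> bool" where
  "extremal \<sigma> L \<longleftrightarrow> (\<sigma> = 1 \<and> L = \<Lambda>) \<or> (\<sigma> = -1 \<and> L = 1 / \<Lambda>)"

lemma extremalD:
  assumes "extremal \<sigma> L"
  shows "0 < L" "1 / \<Lambda> \<le> L" "L \<le> \<Lambda>" "1 / \<Lambda> \<le> 1 / L" "1 / L \<le> \<Lambda>"
  using assms Lambda_ge inverse_Lambda_le by (auto simp: extremal_def)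

text \<open>By \<open>odds_ratio_eq\<close> this is the inverse of the propensity whose odds ratio
  against \<open>e\<close> is the reciprocal of \<rho>.\<close>

definition ipw :: "(real^'a \<Rightarrow> real \<Rightarrow> real) \<Rightarrow> real^'a \<Rightarrow> real \<Rightarrow> real" where
  "ipw \<rho> x y = 1 + (1 - e x) / e x * \<rho> x y"

text \<open>This is \<open>two_level\<close> expressed through the outcome instead of its level. At
  a tie the outcome does not reveal the side of the threshold, so the weight \<open>c\<close> is
  left open there.\<close>

definition threshold_weight :: "real \<Rightarrow> (real^'a \<Rightarrow> real) \<Rightarrow> real^'a \<Rightarrow> real \<Rightarrow> real" where
  "threshold_weight L c x y = (if y > q L x then L else if y < q L x then 1 / L else c x)"

lemma threshold_weight_measurable [measurable]:
  assumes [measurable]: "c \<in> borel_measurable borel" "f \<in> borel_measurable M" "g \<in> borel_measurable M"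
  shows "(\<lambda>w. threshold_weight L c (f w) (g w)) \<in> borel_measurable M"
  unfolding threshold_weight_def by measurable

lemma ipw_measurable [measurable]:
  assumes \<rho>: "(\<lambda>p. \<rho> (fst p) (snd p)) \<in> borel_measurable (borel \<Otimes>\<^sub>M borel)"
    and [measurable]: "f \<in> borel_measurable M" "g \<in> borel_measurable M"
  shows "(\<lambda>w. ipw \<rho> (f w) (g w)) \<in> borel_measurable M"
proof -
  have [measurable]: "(\<lambda>w. \<rho> (f w) (g w)) \<in> borel_measurable M"
    using measurable_compose[OF _ \<rho>, of "\<lambda>w. (f w, g w)" M] by simp
  show ?thesis unfolding ipw_def by measurable
qed

text \<open>The tie weight 1 is a placeholder, since the factor \<open>y - q L x\<close> vanishes at
  a tie.\<close>

definition extremal_term :: "real \<Rightarrow> real^'a \<Rightarrow> real \<Rightarrow> real" where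
  "extremal_term L x y = (y - q L x) * ipw (threshold_weight L (\<lambda>_. 1)) x y"

lemma extremal_term_measurable [measurable]:
  assumes [measurable]: "f \<in> borel_measurable M" "g \<in> borel_measurable M"
  shows "(\<lambda>w. extremal_term L (f w) (g w)) \<in> borel_measurable M"
  unfolding extremal_term_def by measurable

lemma extremal_term_eq: "extremal_term L x y = (y - q L x) * ipw (threshold_weight L c) x y"
  by (simp add: extremal_term_def ipw_def threshold_weight_def)

lemma extremal_term_upper:
  assumes ex: "extremal \<sigma> L" and r: "1 / \<Lambda> \<le> r" "r \<le> \<Lambda>" and e: "0 < e x" "e x < 1"
  shows "\<sigma> * ((y - q L x) * (1 + (1 - e x) / e x * r)) \<le> \<sigma> * extremal_term L x y"
proof -
  \<comment> \<open>For \<sigma> = 1 the threshold weight is the largest admissible value above the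
    quantile and the smallest below it, so the two factors agree in sign. For \<sigma> = -1 the
    roles are exchanged and \<sigma> corrects the sign.\<close>
  have "0 \<le> \<sigma> * ((y - q L x) * (threshold_weight L (\<lambda>_. 1) x y - r))"
    using ex r by (auto simp: extremal_def threshold_weight_def mult_nonneg_nonneg mult_nonpos_nonpos
        mult_nonneg_nonpos mult_nonpos_nonneg)
  moreover have "0 \<le> (1 - e x) / e x" using e by simp
  ultimately have "0 \<le> (1 - e x) / e x * (\<sigma> * ((y - q L x) * (threshold_weight L (\<lambda>_. 1) x y - r)))"
    by (rule mult_nonneg_nonneg[rotated])
  also have "\<dots> = \<sigma> * extremal_term L x y - \<sigma> * ((y - q L x) * (1 + (1 - e x) / e x * r))"
  proof -
    have "a * (\<sigma> * ((y - z) * (t - r))) = \<sigma> * ((y - z) * (1 + a * t)) - \<sigma> * ((y - z) * (1 + a * r))" for a z t :: real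
      by (simp add: algebra_simps)
    then show ?thesis unfolding extremal_term_def ipw_def .
  qed
  finally show ?thesis by simp
qed

text \<open>Monotonicity of the quantile map turns a strict inequality of outcomes into one of
  levels. On a flat stretch of that map, that is at an atom of Y, equality decides nothing.\<close>

lemma y1_vs_q:
  assumes v: "0 < snd (snd w)" "snd (snd w) < 1" and L: "0 < L"
  shows "y1 w > q L (fst w) \<Longrightarrow> two_level L (snd (snd w)) = L"
    and "y1 w < q L (fst w) \<Longrightarrow> two_level L (snd (snd w)) = 1 / L"
proof -
  have t: "0 < L / (L + 1)" "L / (L + 1) < 1" using L by auto
  show "y1 w > q L (fst w) \<Longrightarrow> two_level L (snd (snd w)) = L"
    using G_mono[of "snd (snd w)" "L / (L + 1)" "fst w" True] v t
    by (force simp: two_level_def y1_def q_def)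
  show "y1 w < q L (fst w) \<Longrightarrow> two_level L (snd (snd w)) = 1 / L"
    using G_mono[of "L / (L + 1)" "snd (snd w)" "fst w" True] v t
    by (force simp: two_level_def y1_def q_def)
qed

lemma integrable_q:
  assumes "0 < L"
  shows "integrable \<mu> (q L)" "integrable B (\<lambda>w. q L (fst w))" "integrable P (\<lambda>p. q L (fst p))"
proof -
  show *: "integrable \<mu> (q L)"
    using integrable_quantile[of "L / (L + 1)"] assms by (simp add: q_def[abs_def])
  show "integrable B (\<lambda>w. q L (fst w))" "integrable P (\<lambda>p. q L (fst p))"
    using * by (simp_all add: fst_\<mu>)
qed

lemma two_level_bound: "0 < L \<Longrightarrow> \<bar>two_level L v\<bar> \<le> max L (1 / L)"
  by (auto simp: two_level_def)

text \<open>Off ties, \<open>e\<close> times the threshold inverse weight is the density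
  \<open>weight (two_level L)\<close>, and at ties the factor \<open>y - q\<close> is zero. The
  outcome part then integrates to \<open>\<psi> L\<close> by definition, and the quantile part to
  its plain mean because a unit weight balances it.\<close>

lemma integral_extremal_term:
  assumes L: "0 < L"
  shows "integrable P (\<lambda>p. (if snd (snd p) then 1 else 0) * extremal_term L (fst p) (fst (snd p)))"
    and "(\<integral>p. (if snd (snd p) then 1 else 0) * extremal_term L (fst p) (fst (snd p)) \<partial>P) = \<psi> L - (\<integral>x. q L x \<partial>\<mu>)"
proof -
  have iy: "integrable B (\<lambda>w. weight (two_level L) w * y1 w)"
    and iq: "integrable B (\<lambda>w. weight (two_level L) w * q L (fst w))"
    using integrable_weight[OF two_level_measurable two_level_bound[OF L]] integrable_y1 integrable_q[OF L]
    by auto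
  have eq: "AE w in B. weight (two_level L) w * y1 w - weight (two_level L) w * q L (fst w)
      = e (fst w) * extremal_term L (fst w) (y1 w)"
    using AE_B
  proof eventually_elim
    fix w :: "(real^'a) \<times> real \<times> real"
    assume w: "0 < e (fst w) \<and> e (fst w) < 1 \<and> 0 < snd (snd w) \<and> snd (snd w) < 1
      \<and> 0 < fst (snd w) \<and> fst (snd w) < 1"
    have "e (fst w) * extremal_term L (fst w) (y1 w) = (y1 w - q L (fst w)) *
      (e (fst w) + (1 - e (fst w)) * threshold_weight L (\<lambda>_. 1) (fst w) (y1 w))"
      using w by (simp add: extremal_term_def ipw_def field_simps)
    also have "\<dots> = (y1 w - q L (fst w)) * weight (two_level L) w"
      using y1_vs_q[of w L] w L by (auto simp: weight_def threshold_weight_def)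
    finally show "weight (two_level L) w * y1 w - weight (two_level L) w * q L (fst w)
      = e (fst w) * extremal_term L (fst w) (y1 w)" by (simp add: algebra_simps)
  qed
  have "integrable B (\<lambda>w. weight (two_level L) w * y1 w - weight (two_level L) w * q L (fst w))"
    using iy iq by simp
  then have "integrable B (\<lambda>w. e (fst w) * extremal_term L (fst w) (y1 w))"
    by (rule integrable_cong_AE_imp) (use eq in \<open>auto simp: eq_commute\<close>)
  then show "integrable P (\<lambda>p. (if snd (snd p) then 1 else 0) * extremal_term L (fst p) (fst (snd p)))"
    using P_integral_treated(2)[of "\<lambda>p. extremal_term L (fst p) (snd p)"] by simp
  have "(\<integral>p. (if snd (snd p) then 1 else 0) * extremal_term L (fst p) (fst (snd p)) \<partial>P)
    = (\<integral>w. e (fst w) * extremal_term L (fst w) (y1 w) \<partial>B)"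
    using P_integral_treated(1)[of "\<lambda>p. extremal_term L (fst p) (snd p)"] by simp
  also have "\<dots> = (\<integral>w. weight (two_level L) w * y1 w - weight (two_level L) w * q L (fst w) \<partial>B)"
    by (rule integral_cong_AE) (use eq in \<open>auto simp: eq_commute\<close>)
  also have "\<dots> = \<psi> L - (\<integral>w. weight (two_level L) w * q L (fst w) \<partial>B)"
    using iy iq by (simp add: \<psi>_def)
  also have "(\<integral>w. weight (two_level L) w * q L (fst w) \<partial>B) = (\<integral>x. q L x \<partial>\<mu>)"
    by (rule integral_weight[OF unit_weight_two_level[OF L]]) measurable
  finally show "(\<integral>p. (if snd (snd p) then 1 else 0) * extremal_term L (fst p) (fst (snd p)) \<partial>P) = \<psi> L - (\<integral>x. q L x \<partial>\<mu>)" .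
qed

text \<open>Over the common denominator \<open>e x\<close> the numerator is a convex combination of
  1 and \<open>r\<close>, both at most \<Lambda>. This supplies the dominating function for all
  integrability proofs about inverse weights.\<close>

lemma abs_ipw_le:
  assumes "0 < e x" "e x < 1" "1 / \<Lambda> \<le> r" "r \<le> \<Lambda>"
  shows "\<bar>1 + (1 - e x) / e x * r\<bar> \<le> \<Lambda> / e x"
proof -
  have "0 \<le> r" using assms(3) Lambda_ge by (smt (verit) divide_nonneg_nonneg)
  moreover have "e x * 1 + (1 - e x) * r \<le> e x * \<Lambda> + (1 - e x) * \<Lambda>"
    using assms Lambda_ge by (intro add_mono mult_left_mono) auto
  moreover have "0 \<le> (1 - e x) * r" using assms \<open>0 \<le> r\<close> by simp
  ultimately have "e x + (1 - e x) * r \<le> \<Lambda>" "0 \<le> e x + (1 - e x) * r"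
    using assms by (simp_all add: algebra_simps)
  moreover have "1 + (1 - e x) / e x * r = (e x + (1 - e x) * r) / e x"
    using assms by (simp add: add_divide_distrib)
  ultimately show ?thesis using assms by (simp add: divide_right_mono)
qed

lemma integrable_P_treated_div:
  assumes [measurable]: "h \<in> borel_measurable (borel \<Otimes>\<^sub>M borel)"
    and i: "integrable B (\<lambda>w. h (fst w, y1 w))"
  shows "integrable P (\<lambda>p. (if snd (snd p) then 1 else 0) * (h (fst p, fst (snd p)) / e (fst p)))"
proof -
  have "integrable B (\<lambda>w. e (fst w) * (h (fst w, y1 w) / e (fst w)))"
    by (rule integrable_cong_AE_imp[OF i]) (measurable, use AE_B in \<open>eventually_elim, auto\<close>)
  then show ?thesis
    using P_integral_treated(2)[of "\<lambda>p. h p / e (fst p)"] by simp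
qed

lemma AE_P_overlap: "AE p in P. 0 < e (fst p) \<and> e (fst p) < 1"
  using e_overlap by (simp add: split_beta')

lemma integrable_ipw:
  assumes h [measurable]: "h \<in> borel_measurable (borel \<Otimes>\<^sub>M borel)"
    and i: "integrable B (\<lambda>w. h (fst w, y1 w))"
    and r [measurable]: "(\<lambda>p. \<rho> (fst p) (snd p)) \<in> borel_measurable (borel \<Otimes>\<^sub>M borel)"
    and b: "\<And>x y. 1 / \<Lambda> \<le> \<rho> x y" "\<And>x y. \<rho> x y \<le> \<Lambda>"
  shows "integrable P (\<lambda>p. (if snd (snd p) then 1 else 0) * (h (fst p, fst (snd p)) * ipw \<rho> (fst p) (fst (snd p))))"
proof (rule Bochner_Integration.integrable_bound)
  show "integrable P (\<lambda>p. \<Lambda> * ((if snd (snd p) then 1 else 0) * (h (fst p, fst (snd p)) / e (fst p))))"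
    by (rule integrable_mult_right) (rule integrable_P_treated_div[OF h i])
  have [measurable]: "(\<lambda>p. ipw \<rho> (fst p) (fst (snd p))) \<in> borel_measurable P" by measurable
  show "(\<lambda>p. (if snd (snd p) then 1 else 0) * (h (fst p, fst (snd p)) * ipw \<rho> (fst p) (fst (snd p)))) \<in> borel_measurable P"
    by measurable
  show "AE p in P. norm ((if snd (snd p) then 1 else 0) * (h (fst p, fst (snd p)) * ipw \<rho> (fst p) (fst (snd p))))
    \<le> norm (\<Lambda> * ((if snd (snd p) then 1 else 0) * (h (fst p, fst (snd p)) / e (fst p))))"
    using AE_P_overlap
  proof eventually_elim
    fix p :: "(real^'a) \<times> real \<times> bool"
    assume p: "0 < e (fst p) \<and> e (fst p) < 1"
    have "\<bar>ipw \<rho> (fst p) (fst (snd p))\<bar> \<le> \<Lambda> / e (fst p)"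
      unfolding ipw_def using p b by (intro abs_ipw_le) auto
    then have "\<bar>h (fst p, fst (snd p))\<bar> * \<bar>ipw \<rho> (fst p) (fst (snd p))\<bar> \<le> \<bar>h (fst p, fst (snd p))\<bar> * (\<Lambda> / e (fst p))"
      by (rule mult_left_mono) simp
    then show "norm ((if snd (snd p) then 1 else 0) * (h (fst p, fst (snd p)) * ipw \<rho> (fst p) (fst (snd p))))
    \<le> norm (\<Lambda> * ((if snd (snd p) then 1 else 0) * (h (fst p, fst (snd p)) / e (fst p))))"
      using p Lambda_ge by (simp add: abs_mult field_simps)
  qed
qed

section \<open>Adversarial propensities\<close>

sublocale u01: prob_space "uniform_measure lborel {0..(1::real)}"
  by (rule prob_space_uniform_measure) auto

sublocale ext: prob_space "ext_space P"
  unfolding ext_space_def by (intro prob_space_pair P_prob u01.prob_space_axioms)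

lemma distr_ext_fst: "distr (ext_space P) P fst = P"
  unfolding ext_space_def by (rule u01.distr_pair_fst)

lemma fst_ext [measurable]: "fst \<in> measurable (ext_space P) P"
  unfolding ext_space_def by measurable

lemma ext_integral:
  fixes f :: "(real^'a) \<times> real \<times> bool \<Rightarrow> real"
  assumes "f \<in> borel_measurable P"
  shows "(\<integral>\<omega>. f (fst \<omega>) \<partial>ext_space P) = (\<integral>p. f p \<partial>P)"
    and "integrable (ext_space P) (\<lambda>\<omega>. f (fst \<omega>)) \<longleftrightarrow> integrable P f"
  using integral_distr[OF fst_ext assms] integrable_distr_eq[OF fst_ext assms]
  unfolding distr_ext_fst by auto

lemma AE_ext_overlap: "AE \<omega> in ext_space P. 0 < e (fst (fst \<omega>)) \<and> e (fst (fst \<omega>)) < 1"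
proof -
  have "AE p in distr (ext_space P) P fst. 0 < e (fst p) \<and> e (fst p) < 1"
    unfolding distr_ext_fst by (rule AE_P_overlap)
  from AE_distrD[OF fst_ext this] show ?thesis .
qed

lemma integrable_wexp:
  assumes h [measurable]: "h \<in> borel_measurable (borel \<Otimes>\<^sub>M borel)"
    and i: "integrable B (\<lambda>w. h (fst w, y1 w))"
    and Eb: "Eb \<in> E_infty P e \<Lambda>"
  shows "integrable (ext_space P) (\<lambda>\<omega>. h (fst (fst \<omega>), fst (snd (fst \<omega>))) * (if snd (snd (fst \<omega>)) then 1 else 0) / Eb \<omega>)"
proof (rule Bochner_Integration.integrable_bound)
  have [measurable]: "Eb \<in> borel_measurable (ext_space P)" using Eb by (simp add: E_infty_def)
  have [measurable]: "fst \<in> measurable (ext_space P) (borel \<Otimes>\<^sub>M (borel \<Otimes>\<^sub>M count_space UNIV))"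
    using fst_ext by (simp only: measurable_cong_sets[OF refl sets_P])
  show "integrable (ext_space P) (\<lambda>\<omega>. \<Lambda> * ((if snd (snd (fst \<omega>)) then 1 else 0) * (h (fst (fst \<omega>), fst (snd (fst \<omega>))) / e (fst (fst \<omega>)))))"
    by (intro integrable_mult_right, subst ext_integral(2), measurable)
      (rule integrable_P_treated_div[OF h i])
  show "(\<lambda>\<omega>. h (fst (fst \<omega>), fst (snd (fst \<omega>))) * (if snd (snd (fst \<omega>)) then 1 else 0) / Eb \<omega>) \<in> borel_measurable (ext_space P)"
    by measurable
  have "AE \<omega> in ext_space P. inverse \<Lambda> \<le> odds (Eb \<omega>) / odds (e (fst (fst \<omega>))) \<and>
      odds (Eb \<omega>) / odds (e (fst (fst \<omega>))) \<le> \<Lambda>" using Eb by (simp add: E_infty_def)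
  with AE_ext_overlap show "AE \<omega> in ext_space P. norm (h (fst (fst \<omega>), fst (snd (fst \<omega>))) * (if snd (snd (fst \<omega>)) then 1 else 0) / Eb \<omega>)
     \<le> norm (\<Lambda> * ((if snd (snd (fst \<omega>)) then 1 else 0) * (h (fst (fst \<omega>), fst (snd (fst \<omega>))) / e (fst (fst \<omega>)))))"
  proof eventually_elim
    fix \<omega> :: "((real^'a) \<times> real \<times> bool) \<times> real"
    assume p: "0 < e (fst (fst \<omega>)) \<and> e (fst (fst \<omega>)) < 1"
      "inverse \<Lambda> \<le> odds (Eb \<omega>) / odds (e (fst (fst \<omega>))) \<and>
      odds (Eb \<omega>) / odds (e (fst (fst \<omega>))) \<le> \<Lambda>"
    then obtain r where r: "1 / \<Lambda> \<le> r" "r \<le> \<Lambda>" "1 / Eb \<omega> = 1 + (1 - e (fst (fst \<omega>))) / e (fst (fst \<omega>)) * r"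
      using odds_ratio_bound Lambda_ge by metis
    have "\<bar>1 / Eb \<omega>\<bar> \<le> \<Lambda> / e (fst (fst \<omega>))"
      unfolding r using p r by (intro abs_ipw_le) auto
    then have "\<bar>h (fst (fst \<omega>), fst (snd (fst \<omega>)))\<bar> * \<bar>1 / Eb \<omega>\<bar> \<le> \<bar>h (fst (fst \<omega>), fst (snd (fst \<omega>)))\<bar> * (\<Lambda> / e (fst (fst \<omega>)))"
      by (rule mult_left_mono) simp
    then show "norm (h (fst (fst \<omega>), fst (snd (fst \<omega>))) * (if snd (snd (fst \<omega>)) then 1 else 0) / Eb \<omega>)
     \<le> norm (\<Lambda> * ((if snd (snd (fst \<omega>)) then 1 else 0) * (h (fst (fst \<omega>), fst (snd (fst \<omega>))) / e (fst (fst \<omega>)))))"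
      using p Lambda_ge by (simp add: abs_mult mult.commute)
  qed
qed

lemma wexp_upper:
  assumes ex: "extremal \<sigma> L" and Eb: "Eb \<in> E_infty P e \<Lambda>"
    and feas: "wexp P (\<lambda>p. q L (fst p)) Eb = (\<integral>p. q L (fst p) \<partial>P)"
  shows "\<sigma> * wexp P (\<lambda>p. fst (snd p)) Eb \<le> \<sigma> * \<psi> L"
proof -
  note L = extremalD(1)[OF ex]
  let ?Z = "\<lambda>\<omega>. if snd (snd (fst \<omega>)) then 1 else (0::real)"
  have iY: "integrable (ext_space P) (\<lambda>\<omega>. fst (snd (fst \<omega>)) * ?Z \<omega> / Eb \<omega>)"
    using integrable_wexp[OF _ _ Eb, of snd] integrable_y1 by simp
  have iq: "integrable (ext_space P) (\<lambda>\<omega>. q L (fst (fst \<omega>)) * ?Z \<omega> / Eb \<omega>)"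
    using integrable_wexp[OF _ _ Eb, of "\<lambda>p. q L (fst p)"] integrable_q[OF L] by simp
  have extremal_term_meas: "(\<lambda>p. (if snd (snd p) then 1 else 0) * extremal_term L (fst p) (fst (snd p))) \<in> borel_measurable P"
    using integral_extremal_term(1)[OF L] by auto
  have ib: "integrable (ext_space P) (\<lambda>\<omega>. ?Z \<omega> * extremal_term L (fst (fst \<omega>)) (fst (snd (fst \<omega>))))"
    using ext_integral(2)[OF extremal_term_meas] integral_extremal_term(1)[OF L] by simp
  have "\<sigma> * (wexp P (\<lambda>p. fst (snd p)) Eb - wexp P (\<lambda>p. q L (fst p)) Eb) =
    (\<integral>\<omega>. \<sigma> * (fst (snd (fst \<omega>)) * ?Z \<omega> / Eb \<omega> - q L (fst (fst \<omega>)) * ?Z \<omega> / Eb \<omega>) \<partial>ext_space P)"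
    using iY iq by (simp add: wexp_def)
  also have "\<dots> \<le> (\<integral>\<omega>. \<sigma> * (?Z \<omega> * extremal_term L (fst (fst \<omega>)) (fst (snd (fst \<omega>)))) \<partial>ext_space P)"
  proof (rule integral_mono_AE)
    show "integrable (ext_space P) (\<lambda>\<omega>. \<sigma> * (fst (snd (fst \<omega>)) * ?Z \<omega> / Eb \<omega> - q L (fst (fst \<omega>)) * ?Z \<omega> / Eb \<omega>))"
      using iY iq by simp
    show "integrable (ext_space P) (\<lambda>\<omega>. \<sigma> * (?Z \<omega> * extremal_term L (fst (fst \<omega>)) (fst (snd (fst \<omega>)))))"
      using ib by simp
    have "AE \<omega> in ext_space P. inverse \<Lambda> \<le> odds (Eb \<omega>) / odds (e (fst (fst \<omega>))) \<and>
      odds (Eb \<omega>) / odds (e (fst (fst \<omega>))) \<le> \<Lambda>" using Eb by (simp add: E_infty_def)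
    with AE_ext_overlap show "AE \<omega> in ext_space P. \<sigma> * (fst (snd (fst \<omega>)) * ?Z \<omega> / Eb \<omega> - q L (fst (fst \<omega>)) * ?Z \<omega> / Eb \<omega>)
       \<le> \<sigma> * (?Z \<omega> * extremal_term L (fst (fst \<omega>)) (fst (snd (fst \<omega>))))"
    proof eventually_elim
      fix \<omega> :: "((real^'a) \<times> real \<times> bool) \<times> real"
      assume p: "0 < e (fst (fst \<omega>)) \<and> e (fst (fst \<omega>)) < 1"
        "inverse \<Lambda> \<le> odds (Eb \<omega>) / odds (e (fst (fst \<omega>))) \<and>
        odds (Eb \<omega>) / odds (e (fst (fst \<omega>))) \<le> \<Lambda>"
      then obtain r where r: "1 / \<Lambda> \<le> r" "r \<le> \<Lambda>" "1 / Eb \<omega> = 1 + (1 - e (fst (fst \<omega>))) / e (fst (fst \<omega>)) * r"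
        using odds_ratio_bound Lambda_ge by metis
      have "fst (snd (fst \<omega>)) / Eb \<omega> - q L (fst (fst \<omega>)) / Eb \<omega> = (fst (snd (fst \<omega>)) - q L (fst (fst \<omega>))) * (1 / Eb \<omega>)"
        by (simp add: diff_divide_distrib)
      then show "\<sigma> * (fst (snd (fst \<omega>)) * ?Z \<omega> / Eb \<omega> - q L (fst (fst \<omega>)) * ?Z \<omega> / Eb \<omega>)
       \<le> \<sigma> * (?Z \<omega> * extremal_term L (fst (fst \<omega>)) (fst (snd (fst \<omega>))))"
        using extremal_term_upper[OF ex r(1,2), of "fst (fst \<omega>)" "fst (snd (fst \<omega>))"] p unfolding r(3) by auto
    qed
  qed
  also have "\<dots> = \<sigma> * (\<psi> L - (\<integral>x. q L x \<partial>\<mu>))"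
    using ext_integral(1)[OF extremal_term_meas] integral_extremal_term(2)[OF L] by simp
  \<comment> \<open>Feasibility turns the subtracted quantile term into its plain mean, the constant
    that also stands on the right, so it cancels.\<close>
  finally show ?thesis
    unfolding feas fst_\<mu>(4)[OF q_measurable] by (simp add: algebra_simps)
qed

text \<open>Where \<open>Y\<close> equals the quantile the weight is free and does not affect the objective. Setting it according
  to the sign of the quantile makes the balancing expectation too large for \<open>s = 0\<close> and too small for
  \<open>s = 1\<close>, and it is affine in \<open>s\<close>.\<close>
definition tie :: "real \<Rightarrow> real \<Rightarrow> real^'a \<Rightarrow> real" where
  "tie L s x = (if 0 \<le> q L x then (1 - s) * \<Lambda> + s / \<Lambda> else (1 - s) / \<Lambda> + s * \<Lambda>)"

lemma tie_measurable [measurable]: "tie L s \<in> borel_measurable borel"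
  unfolding tie_def by measurable

lemma tie_bounds:
  assumes "0 \<le> s" "s \<le> 1"
  shows "1 / \<Lambda> \<le> tie L s x" "tie L s x \<le> \<Lambda>"
proof -
  note l = inverse_Lambda_le
  have "(1 - s) * (1 / \<Lambda>) \<le> (1 - s) * \<Lambda>" "s * (1 / \<Lambda>) \<le> s * \<Lambda>"
    using assms l by (intro mult_left_mono; simp)+
  then show "1 / \<Lambda> \<le> tie L s x" "tie L s x \<le> \<Lambda>"
    unfolding tie_def by (auto simp: algebra_simps add_divide_distrib diff_divide_distrib)
qed

text \<open>The weight \<open>two_level L\<close> balances the quantile exactly but depends on the
  latent level. It agrees with the threshold weight off ties; at ties, after multiplication by the
  quantile, it lies between the two extreme values of \<open>tie\<close>. Exact balance is thus
  bracketed and the intermediate value theorem applies.\<close>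

lemma exists_tie:
  assumes ex: "extremal \<sigma> L"
  shows "\<exists>s\<in>{0..1}. (\<integral>p. (if snd (snd p) then 1 else 0) * (q L (fst p) * ipw (threshold_weight L (tie L s)) (fst p) (fst (snd p))) \<partial>P)
     = (\<integral>x. q L x \<partial>\<mu>)"
proof -
  note L = extremalD(1)[OF ex]
  define f where "f s p = (if snd (snd p) then 1 else 0) * (q L (fst p) * ipw (threshold_weight L (tie L s)) (fst p) (fst (snd p)))"
    for s and p :: "(real^'a) \<times> real \<times> bool"
  have i: "integrable P (f s)" if "s \<in> {0..1}" for s
    unfolding f_def
    using integrable_ipw[of "\<lambda>p. q L (fst p)" "threshold_weight L (tie L s)"] integrable_q[OF L] extremalD[OF ex]
      tie_bounds[of s L] that by (simp add: threshold_weight_def)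
  define H where "H s = (\<integral>p. f s p \<partial>P)" for s
  have H_B: "H s = (\<integral>w. e (fst w) * (q L (fst w) * ipw (threshold_weight L (tie L s)) (fst w) (y1 w)) \<partial>B)" for s
    unfolding H_def f_def
    using P_integral_treated(1)[of "\<lambda>p. q L (fst p) * ipw (threshold_weight L (tie L s)) (fst p) (snd p)"] by simp
  have i_B: "integrable B (\<lambda>w. e (fst w) * (q L (fst w) * ipw (threshold_weight L (tie L s)) (fst w) (y1 w)))"
    if "s \<in> {0..1}" for s
    using i[OF that] unfolding f_def
    using P_integral_treated(2)[of "\<lambda>p. q L (fst p) * ipw (threshold_weight L (tie L s)) (fst p) (snd p)"] by simp
  \<comment> \<open>Continuity comes from this formula, so no convergence theorem is involved;
    integrability at the two endpoints is enough.\<close>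
  have affine: "H s = (1 - s) * H 0 + s * H 1" for s
  proof -
    have *: "f s p = (1 - s) * f 0 p + s * f 1 p" for p
    proof -
      let ?t = "\<lambda>s. threshold_weight L (tie L s) (fst p) (fst (snd p))"
      have t: "?t s = (1 - s) * ?t 0 + s * ?t 1"
        by (auto simp: threshold_weight_def tie_def algebra_simps diff_divide_distrib)
      have "z * (y * (1 + a * ((1 - s) * t0 + s * t1))) =
        (1 - s) * (z * (y * (1 + a * t0))) + s * (z * (y * (1 + a * t1)))" for z y a t0 t1 :: real
        by (simp add: algebra_simps)
      then show ?thesis unfolding f_def ipw_def t .
    qed
    show ?thesis unfolding H_def * using i[of 0] i[of 1] by simp
  qed
  have pt: "e (fst w) * (q L (fst w) * ipw (threshold_weight L c) (fst w) (y1 w)) =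
     (e (fst w) + (1 - e (fst w)) * threshold_weight L c (fst w) (y1 w)) * q L (fst w)"
    if "0 < e (fst w)" for w :: "(real^'a) \<times> real \<times> real" and c
    using that by (simp add: ipw_def field_simps)
  have Eq: "(\<integral>w. weight (two_level L) w * q L (fst w) \<partial>B) = (\<integral>x. q L x \<partial>\<mu>)"
    by (rule integral_weight[OF unit_weight_two_level[OF L]]) measurable
  have iq: "integrable B (\<lambda>w. weight (two_level L) w * q L (fst w))"
    using integrable_weight[OF two_level_measurable two_level_bound[OF L]] integrable_q[OF L] by auto
  have tl: "1 / \<Lambda> \<le> two_level L v" "two_level L v \<le> \<Lambda>" for v
    using extremalD[OF ex] by (auto simp: two_level_def)
  have cmp: "two_level L (snd (snd w)) * q L (fst w) \<le> threshold_weight L (tie L 0) (fst w) (y1 w) * q L (fst w)"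
    "threshold_weight L (tie L 1) (fst w) (y1 w) * q L (fst w) \<le> two_level L (snd (snd w)) * q L (fst w)"
    if w: "0 < snd (snd w)" "snd (snd w) < 1" for w
  proof -
    have t: "threshold_weight L (tie L s) (fst w) (y1 w) =
      (if y1 w = q L (fst w) then tie L s (fst w) else two_level L (snd (snd w)))" for s
      using y1_vs_q[OF w L] by (simp add: threshold_weight_def not_less)
    have "two_level L (snd (snd w)) * q L (fst w) \<le> tie L 0 (fst w) * q L (fst w)"
      "tie L 1 (fst w) * q L (fst w) \<le> two_level L (snd (snd w)) * q L (fst w)"
      using mult_right_mono[OF tl(1), of "q L (fst w)" "snd (snd w)"] mult_right_mono[OF tl(2), of "q L (fst w)" "snd (snd w)"]
        mult_right_mono_neg[OF tl(1), of "q L (fst w)" "snd (snd w)"] mult_right_mono_neg[OF tl(2), of "q L (fst w)" "snd (snd w)"]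
      by (auto simp: tie_def not_le)
    then show "two_level L (snd (snd w)) * q L (fst w) \<le> threshold_weight L (tie L 0) (fst w) (y1 w) * q L (fst w)"
      "threshold_weight L (tie L 1) (fst w) (y1 w) * q L (fst w) \<le> two_level L (snd (snd w)) * q L (fst w)"
      by (simp_all add: t)
  qed
  have "(\<integral>x. q L x \<partial>\<mu>) \<le> H 0"
    unfolding H_B Eq[symmetric]
  proof (rule integral_mono_AE[OF iq i_B], simp, use AE_B in eventually_elim)
    fix w :: "(real^'a) \<times> real \<times> real"
    assume w: "0 < e (fst w) \<and> e (fst w) < 1 \<and> 0 < snd (snd w) \<and> snd (snd w) < 1
      \<and> 0 < fst (snd w) \<and> fst (snd w) < 1"
    have "(1 - e (fst w)) * (two_level L (snd (snd w)) * q L (fst w)) \<le>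
      (1 - e (fst w)) * (threshold_weight L (tie L 0) (fst w) (y1 w) * q L (fst w))"
      using w by (intro mult_left_mono cmp) auto
    then show "weight (two_level L) w * q L (fst w) \<le> e (fst w) * (q L (fst w) * ipw (threshold_weight L (tie L 0)) (fst w) (y1 w))"
      using w by (simp add: pt weight_def algebra_simps)
  qed
  moreover have "H 1 \<le> (\<integral>x. q L x \<partial>\<mu>)"
    unfolding H_B Eq[symmetric]
  proof (rule integral_mono_AE[OF i_B iq], simp, use AE_B in eventually_elim)
    fix w :: "(real^'a) \<times> real \<times> real"
    assume w: "0 < e (fst w) \<and> e (fst w) < 1 \<and> 0 < snd (snd w) \<and> snd (snd w) < 1
      \<and> 0 < fst (snd w) \<and> fst (snd w) < 1"
    have "(1 - e (fst w)) * (threshold_weight L (tie L 1) (fst w) (y1 w) * q L (fst w)) \<le>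
      (1 - e (fst w)) * (two_level L (snd (snd w)) * q L (fst w))"
      using w by (intro mult_left_mono cmp) auto
    then show "e (fst w) * (q L (fst w) * ipw (threshold_weight L (tie L 1)) (fst w) (y1 w)) \<le> weight (two_level L) w * q L (fst w)"
      using w by (simp add: pt weight_def algebra_simps)
  qed
  moreover have "continuous_on {0..1} H"
    by (subst affine[abs_def]) (intro continuous_intros)
  ultimately obtain s where "0 \<le> s" "s \<le> 1" "H s = (\<integral>x. q L x \<partial>\<mu>)"
    using IVT2'[of H 1 "\<integral>x. q L x \<partial>\<mu>" 0] by auto
  then show ?thesis unfolding H_def f_def by auto
qed

text \<open>The optimiser is a function of X and Y and ignores the auxiliary uniform variable: one
  scalar constraint can be met by a deterministic choice of the tie weight.\<close>

lemma wexp_attained: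
  assumes ex: "extremal \<sigma> L"
  shows "\<exists>Eb\<in>E_infty P e \<Lambda>. wexp P (\<lambda>p. q L (fst p)) Eb = (\<integral>p. q L (fst p) \<partial>P)
    \<and> wexp P (\<lambda>p. fst (snd p)) Eb = \<psi> L"
proof -
  note L = extremalD(1)[OF ex]
  obtain s where s: "0 \<le> s" "s \<le> 1" and
    bal: "(\<integral>p. (if snd (snd p) then 1 else 0) * (q L (fst p) * ipw (threshold_weight L (tie L s)) (fst p) (fst (snd p))) \<partial>P)
     = (\<integral>x. q L x \<partial>\<mu>)"
    using exists_tie[OF ex] by auto
  define \<rho> where "\<rho> = threshold_weight L (tie L s)"
  have \<rho>: "1 / \<Lambda> \<le> \<rho> x y" "\<rho> x y \<le> \<Lambda>" for x y
    using extremalD[OF ex] tie_bounds[OF s, of L x] by (auto simp: \<rho>_def threshold_weight_def)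
  have \<rho>_pos: "0 < \<rho> x y" for x y
    using \<rho>[of x y] Lambda_ge by (smt (verit) divide_pos_pos)
  have [measurable]: "(\<lambda>p. ipw \<rho> (fst p) (fst (snd p))) \<in> borel_measurable P"
    unfolding \<rho>_def by measurable
  define Eb where "Eb \<omega> = 1 / ipw \<rho> (fst (fst \<omega>)) (fst (snd (fst \<omega>)))" for \<omega> :: "((real^'a) \<times> real \<times> bool) \<times> real"
  have wexp_Eb: "wexp P h Eb = (\<integral>p. (if snd (snd p) then 1 else 0) * (h p * ipw \<rho> (fst p) (fst (snd p))) \<partial>P)"
    if [measurable]: "h \<in> borel_measurable P" for h
  proof -
    have "wexp P h Eb = (\<integral>\<omega>. (if snd (snd (fst \<omega>)) then 1 else 0) * (h (fst \<omega>) * ipw \<rho> (fst (fst \<omega>)) (fst (snd (fst \<omega>)))) \<partial>ext_space P)"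
      unfolding wexp_def by (rule Bochner_Integration.integral_cong) (auto simp: Eb_def)
    also have "\<dots> = (\<integral>p. (if snd (snd p) then 1 else 0) * (h p * ipw \<rho> (fst p) (fst (snd p))) \<partial>P)"
      by (rule ext_integral(1)) measurable
    finally show ?thesis .
  qed
  have "Eb \<in> E_infty P e \<Lambda>"
    unfolding E_infty_def
  proof (intro CollectI conjI)
    have "(\<lambda>\<omega>. ipw \<rho> (fst (fst \<omega>)) (fst (snd (fst \<omega>)))) \<in> borel_measurable (ext_space P)"
      using measurable_compose[OF fst_ext, of "\<lambda>p. ipw \<rho> (fst p) (fst (snd p))" borel] by simp
    then show "Eb \<in> borel_measurable (ext_space P)" unfolding Eb_def[abs_def] by measurable
    show "AE \<omega> in ext_space P. inverse \<Lambda> \<le> odds (Eb \<omega>) / odds (e (fst (fst \<omega>))) \<and>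
        odds (Eb \<omega>) / odds (e (fst (fst \<omega>))) \<le> \<Lambda>"
      using AE_ext_overlap
    proof eventually_elim
      fix \<omega> :: "((real^'a) \<times> real \<times> bool) \<times> real"
      assume p: "0 < e (fst (fst \<omega>)) \<and> e (fst (fst \<omega>)) < 1"
      let ?r = "\<rho> (fst (fst \<omega>)) (fst (snd (fst \<omega>)))"
      have "odds (Eb \<omega>) / odds (e (fst (fst \<omega>))) = 1 / ?r"
        unfolding Eb_def ipw_def using p \<rho>_pos by (intro odds_ratio_eq) auto
      show "inverse \<Lambda> \<le> odds (Eb \<omega>) / odds (e (fst (fst \<omega>))) \<and>
        odds (Eb \<omega>) / odds (e (fst (fst \<omega>))) \<le> \<Lambda>"
        unfolding \<open>_ = 1 / ?r\<close>
        using \<rho>[of "fst (fst \<omega>)" "fst (snd (fst \<omega>))"] \<rho>_pos[of "fst (fst \<omega>)" "fst (snd (fst \<omega>))"] Lambda_ge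
        by (simp add: field_simps)
    qed
  qed
  moreover have q_eq: "wexp P (\<lambda>p. q L (fst p)) Eb = (\<integral>x. q L x \<partial>\<mu>)"
    using bal by (subst wexp_Eb) (simp_all add: \<rho>_def)
  moreover have "wexp P (\<lambda>p. fst (snd p)) Eb = \<psi> L"
  proof -
    let ?Z = "\<lambda>p. if snd (snd p) then 1 else (0::real)"
    have iY: "integrable P (\<lambda>p. ?Z p * (fst (snd p) * ipw \<rho> (fst p) (fst (snd p))))"
      and iq: "integrable P (\<lambda>p. ?Z p * (q L (fst p) * ipw \<rho> (fst p) (fst (snd p))))"
      using integrable_ipw[of snd \<rho>] integrable_ipw[of "\<lambda>p. q L (fst p)" \<rho>] integrable_y1 integrable_q[OF L] \<rho>
      by (auto simp: \<rho>_def)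
    \<comment> \<open>In the difference of objective and constraint the tie weight drops out, so the
      parameter that was fixed by balance leaves the optimal value untouched.\<close>
    have "wexp P (\<lambda>p. fst (snd p)) Eb - wexp P (\<lambda>p. q L (fst p)) Eb =
      (\<integral>p. ?Z p * (fst (snd p) * ipw \<rho> (fst p) (fst (snd p))) - ?Z p * (q L (fst p) * ipw \<rho> (fst p) (fst (snd p))) \<partial>P)"
      using iY iq by (simp add: wexp_Eb)
    also have "\<dots> = (\<integral>p. ?Z p * extremal_term L (fst p) (fst (snd p)) \<partial>P)"
      unfolding extremal_term_eq[of L _ _ "tie L s", folded \<rho>_def]
      by (rule Bochner_Integration.integral_cong) (auto simp: algebra_simps)
    also have "\<dots> = \<psi> L - (\<integral>x. q L x \<partial>\<mu>)" by (rule integral_extremal_term(2)[OF L])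
    finally show ?thesis unfolding q_eq by simp
  qed
  ultimately show ?thesis
    using fst_\<mu>(4)[OF q_measurable] by auto
qed

end

section \<open>Full-data laws\<close>

lemma full_measurable:
  assumes [measurable_cong]: "sets Q = sets full_space"
  shows "fX \<in> borel_measurable Q" "fY0 \<in> borel_measurable Q" "fY1 \<in> borel_measurable Q"
    "fZ \<in> measurable Q (count_space UNIV)" "fU \<in> measurable Q (\<Pi>\<^sub>M i\<in>UNIV. borel)"
    "space Q = UNIV" "observe \<in> measurable Q obs_space"
proof -
  note [measurable_cong] = assms[unfolded full_space_def]
  have [measurable]: "fX \<in> borel_measurable Q" unfolding fX_def by measurable
  have [measurable]: "fY0 \<in> borel_measurable Q" unfolding fY0_def by measurable
  have [measurable]: "fY1 \<in> borel_measurable Q" unfolding fY1_def by measurable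
  have [measurable]: "fZ \<in> measurable Q (count_space UNIV)" unfolding fZ_def by measurable
  have [measurable]: "fU \<in> measurable Q (\<Pi>\<^sub>M i\<in>UNIV. borel)" unfolding fU_def by measurable
  show "fX \<in> borel_measurable Q" "fY0 \<in> borel_measurable Q" "fY1 \<in> borel_measurable Q"
    "fZ \<in> measurable Q (count_space UNIV)" "fU \<in> measurable Q (\<Pi>\<^sub>M i\<in>UNIV. borel)" by fact+
  show "space Q = UNIV"
    using sets_eq_imp_space_eq[OF assms] by (simp add: full_space_def space_pair_measure space_PiM)
  show "observe \<in> measurable Q obs_space"
    unfolding observe_def obs_space_def by measurable
qed

lemma sigma_XU_facts:
  assumes Q: "sets Q = sets full_space"
  shows "subalgebra Q (sigma_XU Q)"
    and "fX \<in> borel_measurable (sigma_XU Q)"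
    and "fU \<in> measurable (sigma_XU Q) (\<Pi>\<^sub>M i\<in>UNIV. borel)"
proof -
  note [measurable] = full_measurable(1,5)[OF Q]
  let ?M = "borel \<Otimes>\<^sub>M (\<Pi>\<^sub>M i\<in>UNIV. (borel :: real measure))"
  have XU: "(\<lambda>w. (fX w, fU w)) \<in> measurable Q ?M" by measurable
  have "sets (sigma_XU Q) \<subseteq> sets Q"
    unfolding sigma_XU_def by (rule sets_image_in_sets[OF refl XU])
  then show "subalgebra Q (sigma_XU Q)"
    by (simp add: subalgebra_def sigma_XU_def)
  have *: "(\<lambda>w. (fX w, fU w)) \<in> measurable (sigma_XU Q) ?M"
    unfolding sigma_XU_def using measurable_space[OF XU] by (intro measurable_vimage_algebra1) blast
  have "(\<lambda>w. fst (fX w, fU w)) \<in> borel_measurable (sigma_XU Q)"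
    by (rule measurable_compose[OF * measurable_fst])
  then show "fX \<in> borel_measurable (sigma_XU Q)" by (simp only: fst_conv)
  have "(\<lambda>w. snd (fX w, fU w)) \<in> measurable (sigma_XU Q) (\<Pi>\<^sub>M i\<in>UNIV. borel)"
    by (rule measurable_compose[OF * measurable_snd])
  then show "fU \<in> measurable (sigma_XU Q) (\<Pi>\<^sub>M i\<in>UNIV. borel)" by (simp only: snd_conv)
qed

section \<open>Bounds for an arbitrary admissible full-data law\<close>

context marginal_sensitivity begin

text \<open>The part of Y(1) in the untreated arm is unobserved, so its mean is reached through the
  treated arm: reweighting by the inverse latent propensity reproduces the law of
  \<open>fY1\<close>, and the reweighted treated outcome is dominated by an observed quantity. After
  that the argument is the one for a feasible propensity.\<close>

lemma PI_upper:
  assumes ex: "extremal \<sigma> L" and comp: "compatible P Q" and msm: "MSM \<Lambda> e Q"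
  shows "\<sigma> * integral\<^sup>L Q fY1 \<le> \<sigma> * \<psi> L"
proof -
  note L = extremalD(1)[OF ex]
  have sQ: "sets Q = sets full_space" and PQ: "distr Q obs_space observe = P" and "prob_space Q"
    using comp by (auto simp: compatible_def)
  interpret Q: prob_space Q by fact
  let ?F = "sigma_XU Q"
  interpret XU: finite_measure_subalgebra Q ?F
    by unfold_locales (rule sigma_XU_facts[OF sQ])
  note [measurable] = full_measurable(1-5)[OF sQ]
  note obs = full_measurable(7)[OF sQ]
  have obs' [measurable]: "observe \<in> measurable Q P" using obs by (simp only: measurable_cong_sets[OF refl P_sets])
  have PQ': "distr Q P observe = P" 
  proof -
    have "distr Q P observe = distr Q obs_space observe" by (rule distr_cong) (simp_all add: P_sets)
    then show ?thesis using PQ by (rule trans)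
  qed
  note XUm = sigma_XU_facts(2)[OF sQ]
  define e0 where "e0 = latent_prop Q"
  define Z where "Z w = (if fZ w then 1 else (0::real))" for w :: "(real^'a) \<times> real \<times> real \<times> bool \<times> (nat \<Rightarrow> real)"
  have Z_meas [measurable]: "Z \<in> borel_measurable Q" unfolding Z_def[abs_def] by measurable
  have e0F: "e0 \<in> borel_measurable ?F" unfolding e0_def latent_prop_def by simp
  then have [measurable]: "e0 \<in> borel_measurable Q" by (rule measurable_from_subalg[OF XU.subalg])
  have e0_Z: "e0 = real_cond_exp Q ?F Z" by (simp add: e0_def latent_prop_def Z_def[abs_def])

  have "AE p in distr Q P observe. 0 < e (fst p) \<and> e (fst p) < 1" unfolding PQ' by (rule AE_P_overlap)
  from AE_distrD[OF obs' this] have ov: "AE w in Q. 0 < e (fX w) \<and> e (fX w) < 1"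
    by (simp add: observe_def)
  have "AE w in Q. inverse \<Lambda> \<le> odds (e0 w) / odds (e (fX w)) \<and> odds (e0 w) / odds (e (fX w)) \<le> \<Lambda>"
    using msm by (simp add: MSM_def e0_def)
  with ov have e0: "AE w in Q. 0 < e (fX w) \<and> e (fX w) < 1 \<and> 0 < e0 w \<and> e0 w < 1 \<and>
    (\<exists>r. 1 / \<Lambda> \<le> r \<and> r \<le> \<Lambda> \<and> 1 / e0 w = 1 + (1 - e (fX w)) / e (fX w) * r)"
  proof eventually_elim
    case (elim w)
    then show ?case
      by (auto elim!: odds_ratio_bound[of "e (fX w)" \<Lambda> "e0 w"] simp: Lambda_ge)
  qed

  have Y_obs: "(if snd (snd (observe w)) then 1 else 0) * h (fst (observe w), fst (snd (observe w))) = Z w * h (fX w, fY1 w)"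
    for h :: "(real^'a) \<times> real \<Rightarrow> real" and w
    by (simp add: observe_def Z_def)
  have Q_int: "integrable Q (\<lambda>w. Z w * h (fX w, fY1 w))"
    "(\<integral>w. Z w * h (fX w, fY1 w) \<partial>Q) = (\<integral>p. (if snd (snd p) then 1 else 0) * h (fst p, fst (snd p)) \<partial>P)"
    if h [measurable]: "h \<in> borel_measurable (borel \<Otimes>\<^sub>M borel)"
      and i: "integrable P (\<lambda>p. (if snd (snd p) then 1 else 0) * h (fst p, fst (snd p)))"
    for h :: "(real^'a) \<times> real \<Rightarrow> real"
  proof -
    have m: "(\<lambda>p. (if snd (snd p) then 1 else 0) * h (fst p, fst (snd p))) \<in> borel_measurable P" by measurable
    show "integrable Q (\<lambda>w. Z w * h (fX w, fY1 w))"
      using integrable_distr_eq[OF obs' m] i unfolding PQ' Y_obs by simp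
    show "(\<integral>w. Z w * h (fX w, fY1 w) \<partial>Q) = (\<integral>p. (if snd (snd p) then 1 else 0) * h (fst p, fst (snd p)) \<partial>P)"
      using integral_distr[OF obs' m] unfolding PQ' Y_obs by simp
  qed

  have weighted: "integrable Q (\<lambda>w. h (fX w, fY1 w) * (Z w / e0 w))"
    if h [measurable]: "h \<in> borel_measurable (borel \<Otimes>\<^sub>M borel)" and i: "integrable B (\<lambda>w. h (fst w, y1 w))"
    for h :: "(real^'a) \<times> real \<Rightarrow> real"
  proof (rule Bochner_Integration.integrable_bound)
    show "integrable Q (\<lambda>w. \<Lambda> * (Z w * (h (fX w, fY1 w) / e (fX w))))"
      using Q_int(1)[of "\<lambda>p. h p / e (fst p)"] integrable_P_treated_div[OF h i]
      by (intro integrable_mult_right) simp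
    show "(\<lambda>w. h (fX w, fY1 w) * (Z w / e0 w)) \<in> borel_measurable Q" by measurable
    show "AE w in Q. norm (h (fX w, fY1 w) * (Z w / e0 w)) \<le> norm (\<Lambda> * (Z w * (h (fX w, fY1 w) / e (fX w))))"
      using e0
    proof eventually_elim
      case (elim w)
      then obtain r where r: "1 / \<Lambda> \<le> r" "r \<le> \<Lambda>" "1 / e0 w = 1 + (1 - e (fX w)) / e (fX w) * r" by auto
      have "\<bar>1 / e0 w\<bar> \<le> \<Lambda> / e (fX w)" unfolding r using elim r by (intro abs_ipw_le) auto
      then have "\<bar>h (fX w, fY1 w)\<bar> * \<bar>1 / e0 w\<bar> \<le> \<bar>h (fX w, fY1 w)\<bar> * (\<Lambda> / e (fX w))"
        by (rule mult_left_mono) simp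
      then show ?case using elim Lambda_ge by (simp add: Z_def abs_mult mult.commute)
    qed
  qed

  \<comment> \<open>The latent propensity is the conditional expectation of Z given X and U, and
    \<open>q L (fX w) / e0 w\<close> is measurable for these variables. Replacing Z by
    \<open>e0\<close> under the integral cancels the denominator, so the balancing constraint holds
    automatically.\<close>
  have q_eq: "(\<integral>w. q L (fX w) * (Z w / e0 w) \<partial>Q) = (\<integral>x. q L x \<partial>\<mu>)"
  proof -
    have i: "integrable Q (\<lambda>w. q L (fX w) / e0 w * Z w)"
      using weighted[of "\<lambda>p. q L (fst p)"] integrable_q[OF L] by simp
    have fF: "(\<lambda>w. q L (fX w) / e0 w) \<in> borel_measurable ?F" using e0F XUm by measurable
    have "(\<integral>w. q L (fX w) * (Z w / e0 w) \<partial>Q) = (\<integral>w. q L (fX w) / e0 w * Z w \<partial>Q)" by simp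
    also have "\<dots> = (\<integral>w. q L (fX w) / e0 w * e0 w \<partial>Q)"
      unfolding e0_Z using XU.real_cond_exp_intg(2)[OF i fF Z_meas] by (simp add: e0_Z)
    also have "\<dots> = (\<integral>w. q L (fX w) \<partial>Q)"
      by (rule integral_cong_AE) (measurable, use e0 in \<open>eventually_elim, auto\<close>)
    also have "\<dots> = (\<integral>w. q L (fst (observe w)) \<partial>Q)" by (simp add: observe_def)
    also have "\<dots> = (\<integral>p. q L (fst p) \<partial>P)"
      using integral_distr[OF obs', of "\<lambda>p. q L (fst p)"] unfolding PQ' by simp
    finally show ?thesis unfolding fst_\<mu>(4)[OF q_measurable] .
  qed

  \<comment> \<open>Conditional independence is a statement about events, hence the indicators: it
    factors the conditional expectation into that of the event times \<open>e0\<close>, and dividing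
    by \<open>e0\<close> leaves the probability of the event.\<close>
  have Y_law: "(\<integral>w. indicator A (fY1 w) * (Z w / e0 w) \<partial>Q) = measure Q (fY1 -` A)"
    if [measurable]: "A \<in> sets borel" for A
  proof -
    let ?I = "\<lambda>w. indicator A (fY1 w) :: real"
    have i1: "integrable B (\<lambda>w. indicator A (y1 w) :: real)"
      by (rule B.integrable_const_bound[where B=1]) auto
    have i: "integrable Q (\<lambda>w. 1 / e0 w * (?I w * Z w))"
      using weighted[of "\<lambda>p. indicator A (snd p)"] i1 by (simp add: mult.commute mult.left_commute)
    have iI: "integrable Q ?I" by (rule Q.integrable_const_bound[where B=1]) auto
    have fF: "(\<lambda>w. 1 / e0 w) \<in> borel_measurable ?F" using e0F by measurable
    have "(UNIV :: real set) \<times> A \<in> sets (borel \<Otimes>\<^sub>M borel)" by measurable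
    then have ae: "AE w in Q. real_cond_exp Q ?F
          (\<lambda>w. indicator (UNIV \<times> A) (fY0 w, fY1 w) * indicator {True} (fZ w)) w
          = real_cond_exp Q ?F (\<lambda>w. indicator (UNIV \<times> A) (fY0 w, fY1 w)) w
            * real_cond_exp Q ?F (\<lambda>w. indicator {True} (fZ w)) w"
      using msm unfolding MSM_def cond_indep_Y_Z_given_XU_def by blast
    have m1: "(\<lambda>w. 1 / e0 w * real_cond_exp Q ?F (\<lambda>w. ?I w * Z w) w) \<in> borel_measurable Q"
      by (intro borel_measurable_times borel_measurable_divide borel_measurable_cond_exp2) simp_all
    have ind: "indicator (UNIV \<times> A) (fY0 w, fY1 w) = ?I w" "indicator {True} (fZ w) = Z w" for w
      by (auto simp: Z_def split: split_indicator)
    have ci: "AE w in Q. real_cond_exp Q ?F (\<lambda>w. ?I w * Z w) w = real_cond_exp Q ?F ?I w * e0 w"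
      using ae unfolding ind e0_Z .
    have "(\<integral>w. ?I w * (Z w / e0 w) \<partial>Q) = (\<integral>w. 1 / e0 w * (?I w * Z w) \<partial>Q)" by simp
    also have "\<dots> = (\<integral>w. 1 / e0 w * real_cond_exp Q ?F (\<lambda>w. ?I w * Z w) w \<partial>Q)"
      by (rule XU.real_cond_exp_intg(2)[OF i fF, symmetric]) measurable
    also have "\<dots> = (\<integral>w. real_cond_exp Q ?F ?I w \<partial>Q)"
      by (rule integral_cong_AE[OF m1 borel_measurable_cond_exp2]) (use ci e0 in \<open>eventually_elim, auto\<close>)
    also have "\<dots> = (\<integral>w. ?I w \<partial>Q)" by (rule XU.real_cond_exp_int(2)[OF iI])
    also have "\<dots> = (\<integral>w. indicator (fY1 -` A) w \<partial>Q)"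
      by (rule Bochner_Integration.integral_cong) (auto split: split_indicator)
    also have "\<dots> = measure Q (fY1 -` A)"
      using full_measurable(6)[OF sQ] by simp
    finally show ?thesis .
  qed

  have nn: "AE w in Q. 0 \<le> Z w / e0 w" using e0 by eventually_elim (auto simp: Z_def)
  \<comment> \<open>Equality of laws carries the identity from events to the possibly unbounded
    \<open>fY1\<close> without knowing beforehand that it is integrable.\<close>
  have law: "distr (density Q (\<lambda>w. ennreal (Z w / e0 w))) borel fY1 = distr Q borel fY1"
  proof (rule measure_eqI)
    fix A assume "A \<in> sets (distr (density Q (\<lambda>w. ennreal (Z w / e0 w))) borel fY1)"
    then have A [measurable]: "A \<in> sets borel" by simp
    have [measurable]: "fY1 -` A \<in> sets Q"
      using measurable_sets[of fY1 Q borel A] full_measurable(6)[OF sQ] by simp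
    have i1: "integrable B (\<lambda>w. indicator A (y1 w) :: real)"
      by (rule B.integrable_const_bound[where B=1]) auto
    have "emeasure (distr (density Q (\<lambda>w. ennreal (Z w / e0 w))) borel fY1) A
      = emeasure (density Q (\<lambda>w. ennreal (Z w / e0 w))) (fY1 -` A)"
      using full_measurable(6)[OF sQ] by (subst emeasure_distr) auto
    also have "\<dots> = (\<integral>\<^sup>+w. ennreal (Z w / e0 w) * indicator (fY1 -` A) w \<partial>Q)"
      by (rule emeasure_density) measurable
    also have "\<dots> = (\<integral>\<^sup>+w. ennreal (indicator A (fY1 w) * (Z w / e0 w)) \<partial>Q)"
      by (rule nn_integral_cong) (auto split: split_indicator)
    also have "\<dots> = ennreal (\<integral>w. indicator A (fY1 w) * (Z w / e0 w) \<partial>Q)"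
      using weighted[of "\<lambda>p. indicator A (snd p)"] i1 nn
      by (intro nn_integral_eq_integral) (auto split: split_indicator)
    also have "\<dots> = emeasure (distr Q borel fY1) A"
      unfolding Y_law[OF A] using full_measurable(6)[OF sQ]
      by (subst emeasure_distr) (auto simp: Q.emeasure_eq_measure)
    finally show "emeasure (distr (density Q (\<lambda>w. ennreal (Z w / e0 w))) borel fY1) A = emeasure (distr Q borel fY1) A" .
  qed simp

  have Y_eq: "(\<integral>w. fY1 w \<partial>Q) = (\<integral>w. fY1 w * (Z w / e0 w) \<partial>Q)"
  proof -
    have "(\<integral>w. fY1 w \<partial>Q) = (\<integral>y. y \<partial>distr Q borel fY1)" by (subst integral_distr) auto
    also have "\<dots> = (\<integral>w. fY1 w \<partial>density Q (\<lambda>w. ennreal (Z w / e0 w)))"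
      unfolding law[symmetric] by (subst integral_distr) auto
    also have "\<dots> = (\<integral>w. fY1 w * (Z w / e0 w) \<partial>Q)"
      using nn by (subst integral_density) (auto simp: mult.commute)
    finally show ?thesis .
  qed

  have iY: "integrable Q (\<lambda>w. fY1 w * (Z w / e0 w))"
    using weighted[of snd] integrable_y1 by simp
  have iq: "integrable Q (\<lambda>w. q L (fX w) * (Z w / e0 w))"
    using weighted[of "\<lambda>p. q L (fst p)"] integrable_q[OF L] by simp
  have ib: "integrable Q (\<lambda>w. Z w * extremal_term L (fX w) (fY1 w))"
    and extremal_term_eq: "(\<integral>w. Z w * extremal_term L (fX w) (fY1 w) \<partial>Q) = \<psi> L - (\<integral>x. q L x \<partial>\<mu>)"
    using Q_int[of "\<lambda>p. extremal_term L (fst p) (snd p)"] integral_extremal_term[OF L] by simp_all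
  have "\<sigma> * ((\<integral>w. fY1 w \<partial>Q) - (\<integral>x. q L x \<partial>\<mu>)) =
    (\<integral>w. \<sigma> * (fY1 w * (Z w / e0 w) - q L (fX w) * (Z w / e0 w)) \<partial>Q)"
    unfolding Y_eq q_eq[symmetric] using iY iq by simp
  also have "\<dots> \<le> (\<integral>w. \<sigma> * (Z w * extremal_term L (fX w) (fY1 w)) \<partial>Q)"
  proof (rule integral_mono_AE)
    show "integrable Q (\<lambda>w. \<sigma> * (fY1 w * (Z w / e0 w) - q L (fX w) * (Z w / e0 w)))" using iY iq by simp
    show "integrable Q (\<lambda>w. \<sigma> * (Z w * extremal_term L (fX w) (fY1 w)))" using ib by simp
    show "AE w in Q. \<sigma> * (fY1 w * (Z w / e0 w) - q L (fX w) * (Z w / e0 w)) \<le> \<sigma> * (Z w * extremal_term L (fX w) (fY1 w))"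
      using e0
    proof eventually_elim
      case (elim w)
      then obtain r where r: "1 / \<Lambda> \<le> r" "r \<le> \<Lambda>" "1 / e0 w = 1 + (1 - e (fX w)) / e (fX w) * r" by auto
      have "fY1 w / e0 w - q L (fX w) / e0 w = (fY1 w - q L (fX w)) * (1 / e0 w)"
        by (simp add: diff_divide_distrib)
      then show ?case
        using extremal_term_upper[OF ex r(1,2), of "fX w" "fY1 w"] elim unfolding r(3) by (auto simp: Z_def)
    qed
  qed
  also have "\<dots> = \<sigma> * (\<psi> L - (\<integral>x. q L x \<partial>\<mu>))" using extremal_term_eq by simp
  finally show ?thesis by (simp add: algebra_simps)
qed


section \<open>Full-data laws that realise the bounds\<close>

definition latent :: "(real^'a) \<times> real \<times> real \<Rightarrow> nat \<Rightarrow> real" where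
  "latent w = (\<lambda>i. if i = 0 then fst (snd w) else if i = 1 then snd (snd w) else 0)"

lemma latent_measurable [measurable]:
  "latent \<in> measurable (borel \<Otimes>\<^sub>M (borel \<Otimes>\<^sub>M borel)) (\<Pi>\<^sub>M i\<in>UNIV. borel)"
proof (rule measurable_PiM_single')
  fix i :: nat
  show "(\<lambda>w. latent w i) \<in> borel_measurable (borel \<Otimes>\<^sub>M (borel \<Otimes>\<^sub>M borel))"
    unfolding latent_def by (cases "i = 0"; cases "i = 1"; simp)
qed auto

definition full_data :: "((real^'a) \<times> real \<times> real) \<times> bool \<Rightarrow> (real^'a) \<times> real \<times> real \<times> bool \<times> (nat \<Rightarrow> real)" where
  "full_data p = (fst (fst p), G (fst (fst p)) False (fst (snd (fst p))), G (fst (fst p)) True (snd (snd (fst p))),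
     snd p, latent (fst p))"

lemma full_data_measurable [measurable]: "full_data \<in> measurable (D r) full_space"
  unfolding full_data_def full_space_def by measurable

text \<open>The latent variable consists of the uniform variables that generate the potential outcomes, which makes
  the potential outcomes functions of \<open>(X, U)\<close>.\<close>
definition full_law :: "(real \<Rightarrow> real) \<Rightarrow> ((real^'a) \<times> real \<times> real \<times> bool \<times> (nat \<Rightarrow> real)) measure" where
  "full_law r = distr (D r) full_space full_data"

lemma sets_full_law: "sets (full_law r) = sets full_space"
  by (simp add: full_law_def)

lemma compatible_full_law:
  assumes r: "unit_weight r"
  shows "compatible P (full_law r)"
proof -
  interpret D: prob_space "D r" by (rule prob_space_D[OF r])
  have "prob_space (full_law r)"
    unfolding full_law_def by (rule D.prob_space_distr) measurable
  moreover have "distr (full_law r) obs_space observe = P"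
  proof -
    have o: "observe \<in> measurable full_space obs_space"
      by (rule full_measurable(7)) simp
    have "distr (full_law r) obs_space observe = distr (D r) obs_space (observe \<circ> full_data)"
      unfolding full_law_def by (rule distr_distr[OF o full_data_measurable])
    also have "observe \<circ> full_data = Obs"
      by (auto simp: fun_eq_iff observe_def full_data_def Obs_def fX_def fY0_def fY1_def fZ_def)
    finally show ?thesis by (simp add: distr_D_Obs[OF r])
  qed
  ultimately show ?thesis by (simp add: compatible_def sets_full_law)
qed

lemma integral_full_law_Y1:
  assumes r: "unit_weight r"
  shows "integral\<^sup>L (full_law r) fY1 = (\<integral>w. weight r w * y1 w \<partial>B)"
proof -
  have "fY1 \<in> borel_measurable full_space" by (rule full_measurable(3)) simp
  then have "integral\<^sup>L (full_law r) fY1 = (\<integral>p. fY1 (full_data p) \<partial>D r)"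
    unfolding full_law_def by (rule integral_distr[OF full_data_measurable])
  also have "\<dots> = (\<integral>p. y1 (fst p) \<partial>D r)"
    by (simp add: fY1_def full_data_def y1_def)
  also have "\<dots> = (\<integral>w. weight r w * y1 w \<partial>B)"
    by (rule D_integral[OF r]) measurable
  finally show ?thesis .
qed

lemma AE_full_law:
  assumes "{w \<in> space full_space. Q w} \<in> sets full_space" and "AE p in D r. Q (full_data p)"
  shows "AE w in full_law r. Q w"
  unfolding full_law_def using AE_distr_iff[OF full_data_measurable assms(1)] assms(2) by simp

lemma AE_D:
  assumes r: "unit_weight r" and Q: "AE w in B. Q w" and m: "{w. Q w} \<in> sets (borel \<Otimes>\<^sub>M (borel \<Otimes>\<^sub>M borel))"
  shows "AE p in D r. Q (fst p)"
proof -
  note [measurable] = unit_weightD(1)[OF r]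
  have "AE w in distr (D r) B fst. Q w"
    unfolding distr_D_fst[OF r] using Q by (subst AE_density) auto
  moreover have "fst \<in> measurable (D r) B" by measurable
  ultimately show ?thesis by (rule AE_distrD[rotated])
qed

lemma MSM_full_law:
  assumes r: "unit_weight r" and b: "\<And>v. 1 / \<Lambda> \<le> r v" "\<And>v. r v \<le> \<Lambda>"
  shows "MSM \<Lambda> e (full_law r)"
proof -
  let ?Q = "full_law r" and ?F = "sigma_XU (full_law r)"
  note [measurable] = unit_weightD(1)[OF r]
  have r_pos: "0 < r v" for v
    using b(1)[of v] Lambda_ge by (smt (verit) divide_pos_pos)
  interpret Q: prob_space ?Q using compatible_full_law[OF r] by (simp add: compatible_def)
  interpret XU: finite_measure_subalgebra ?Q ?F
    by unfold_locales (rule sigma_XU_facts[OF sets_full_law])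
  note Qm = full_measurable(1-5)[OF sets_full_law[of r]]
  note fm = full_measurable(1-5)[OF refl[of "sets full_space"]]
  have spf: "space full_space = UNIV" by (rule full_measurable(6)) simp
  note XUm = sigma_XU_facts(2,3)[OF sets_full_law[of r]]
  have Ui: "(\<lambda>w. fU w i) \<in> borel_measurable ?F" for i
    using measurable_compose[OF XUm(2) measurable_component_singleton[of i UNIV "\<lambda>_. borel"]] by simp
  have Ui': "(\<lambda>w. fU w i) \<in> borel_measurable full_space" for i
    using measurable_compose[OF fm(5) measurable_component_singleton[of i UNIV "\<lambda>_. borel"]] by simp

  have "cond_indep_Y_Z_given_XU ?Q"
    unfolding cond_indep_Y_Z_given_XU_def
  proof (intro ballI allI)
    fix A :: "(real \<times> real) set" and C :: "bool set"
    assume A [measurable]: "A \<in> sets (borel \<Otimes>\<^sub>M borel)"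
    let ?I = "\<lambda>w :: (real^'a) \<times> real \<times> real \<times> bool \<times> (nat \<Rightarrow> real). indicator A (fY0 w, fY1 w) :: real"
    let ?J = "\<lambda>w :: (real^'a) \<times> real \<times> real \<times> bool \<times> (nat \<Rightarrow> real). indicator C (fZ w) :: real"
    let ?f = "\<lambda>w. indicator A (G (fX w) False (fU w 0), G (fX w) True (fU w 1)) :: real"
    have IQ: "?I \<in> borel_measurable ?Q" and JQ: "?J \<in> borel_measurable ?Q" and IJQ: "(\<lambda>w. ?I w * ?J w) \<in> borel_measurable ?Q"
      using Qm by measurable
    have fF: "?f \<in> borel_measurable ?F"
      using XUm(1) Ui[of 0] Ui[of 1] by measurable
    have fQ: "?f \<in> borel_measurable ?Q" by (rule measurable_from_subalg[OF XU.subalg fF])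
    have fJQ: "(\<lambda>w. ?f w * ?J w) \<in> borel_measurable ?Q" using fQ JQ by measurable
    \<comment> \<open>Given X and U the potential outcomes are known, so the indicator of their
      event is measurable for the conditioning variables and pulls out of the conditional
      expectation.\<close>
    have If: "AE w in ?Q. ?I w = ?f w"
    proof (rule AE_full_law)
      show "{w \<in> space full_space. ?I w = ?f w} \<in> sets full_space"
        using fm Ui'[of 0] Ui'[of 1] by measurable
      show "AE p in D r. ?I (full_data p) = ?f (full_data p)"
        by (simp add: full_data_def fX_def fY0_def fY1_def fU_def latent_def)
    qed
    then have IJf: "AE w in ?Q. ?I w * ?J w = ?f w * ?J w" by eventually_elim simp
    have i: "integrable ?Q (\<lambda>w. ?f w * ?J w)"
      by (rule Q.integrable_const_bound[where B=1, OF _ fJQ]) (auto split: split_indicator)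
    have if': "integrable ?Q ?f"
      by (rule Q.integrable_const_bound[where B=1, OF _ fQ]) (auto split: split_indicator)
    show "AE w in ?Q. real_cond_exp ?Q ?F (\<lambda>w. ?I w * ?J w) w = real_cond_exp ?Q ?F ?I w * real_cond_exp ?Q ?F ?J w"
      using XU.real_cond_exp_cong[OF IJf IJQ fJQ] XU.real_cond_exp_cong[OF If IQ fQ]
        XU.real_cond_exp_mult[OF fF JQ i] XU.real_cond_exp_F_meas[OF if' fF]
      by eventually_elim simp
  qed

  moreover
  \<comment> \<open>The candidate latent propensity comes from Bayes' rule: it is the treated
    density \<open>e\<close> divided by the total density \<open>weight r\<close>.\<close>
  define g where "g x v = 1 / (1 + (1 - e x) / e x * r v)" for x :: "real^'a" and v
  have [measurable]: "(\<lambda>w. g (f w) (h w)) \<in> borel_measurable M"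
    if [measurable]: "f \<in> borel_measurable M" "h \<in> borel_measurable M" for f h M
    unfolding g_def by measurable
  have g01: "0 \<le> g x v" "g x v \<le> 1" if "0 < e x" "e x < 1" for x v
  proof -
    have "0 \<le> (1 - e x) / e x * r v" using that r_pos[of v] by simp
    then show "0 \<le> g x v" "g x v \<le> 1" by (simp_all add: g_def)
  qed
  let ?Z = "\<lambda>w :: (real^'a) \<times> real \<times> real \<times> bool \<times> (nat \<Rightarrow> real). if fZ w then 1 else (0::real)"
  let ?g = "\<lambda>w. g (fX w) (fU w 1)"
  have ovD: "AE p in D r. 0 < e (fst (fst p)) \<and> e (fst (fst p)) < 1"
  proof (rule AE_D[OF r])
    show "AE w in B. 0 < e (fst w) \<and> e (fst w) < 1" using AE_B by eventually_elim auto
    have "{w \<in> space (borel \<Otimes>\<^sub>M (borel \<Otimes>\<^sub>M borel)). 0 < e (fst w) \<and> e (fst w) < 1} \<in> sets (borel \<Otimes>\<^sub>M (borel \<Otimes>\<^sub>M borel :: (real \<times> real) measure))"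
      by measurable
    then show "{w. 0 < e (fst w) \<and> e (fst w) < 1} \<in> sets (borel \<Otimes>\<^sub>M (borel \<Otimes>\<^sub>M borel :: (real \<times> real) measure))"
      by (simp add: space_pair_measure)
  qed
  have ov: "AE w in ?Q. 0 < e (fX w) \<and> e (fX w) < 1"
  proof (rule AE_full_law)
    show "{w \<in> space full_space. 0 < e (fX w) \<and> e (fX w) < 1} \<in> sets full_space"
      using fm by measurable
    show "AE p in D r. 0 < e (fX (full_data p)) \<and> e (fX (full_data p)) < 1"
      using ovD by (simp add: fX_def full_data_def)
  qed
  have gF: "?g \<in> borel_measurable ?F" using XUm(1) Ui[of 1] by measurable
  have gQ: "?g \<in> borel_measurable ?Q" by (rule measurable_from_subalg[OF XU.subalg gF])
  have gfull: "?g \<in> borel_measurable full_space" using fm(1) Ui'[of 1] by measurable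
  have ig: "integrable ?Q ?g"
    by (rule Q.integrable_const_bound[where B=1, OF _ gQ])
      (use ov in \<open>eventually_elim, use g01 in auto\<close>)
  have ZQ: "?Z \<in> borel_measurable ?Q" using Qm(4) by measurable
  have iZ: "integrable ?Q ?Z"
    by (rule Q.integrable_const_bound[where B=1, OF _ ZQ]) auto
  have "AE w in ?Q. real_cond_exp ?Q ?F ?Z w = ?g w"
  proof (rule XU.real_cond_exp_charact[OF _ iZ ig gF])
    fix A assume "A \<in> sets ?F"
    then obtain S where S [measurable]: "S \<in> sets (borel \<Otimes>\<^sub>M (\<Pi>\<^sub>M i\<in>UNIV. (borel :: real measure)))"
      and A: "A = (\<lambda>w. (fX w, fU w)) -` S \<inter> space ?Q"
      unfolding sigma_XU_def by (subst (asm) sets_vimage_algebra2) (auto simp: space_pair_measure space_PiM)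
    have Q_UNIV: "space ?Q = UNIV" by (rule full_measurable(6)[OF sets_full_law])
    let ?S = "\<lambda>w :: (real^'a) \<times> real \<times> real. indicator S (fst w, latent w) :: real"
    have set_eq: "(\<integral>w\<in>A. h w \<partial>?Q) = (\<integral>p. ?S (fst p) * h (full_data p) \<partial>D r)"
      if h: "h \<in> borel_measurable full_space" for h :: "_ \<Rightarrow> real"
    proof -
      have "(\<integral>w\<in>A. h w \<partial>?Q) = (\<integral>w. indicator S (fX w, fU w) * h w \<partial>?Q)"
        unfolding set_lebesgue_integral_def
        by (rule Bochner_Integration.integral_cong) (auto simp: A Q_UNIV split: split_indicator)
      also have "\<dots> = (\<integral>p. indicator S (fX (full_data p), fU (full_data p)) * h (full_data p) \<partial>D r)"
        unfolding full_law_def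
        by (rule integral_distr[OF full_data_measurable]) (use fm h in measurable)
      also have "\<dots> = (\<integral>p. ?S (fst p) * h (full_data p) \<partial>D r)"
        by (simp add: fX_def fU_def full_data_def)
      finally show ?thesis .
    qed
    have "(\<integral>w\<in>A. ?Z w \<partial>?Q) = (\<integral>p. ?S (fst p) * ?Z (full_data p) \<partial>D r)"
      by (rule set_eq) (use fm(4) in measurable)
    also have "\<dots> = (\<integral>p. (if snd p then 1 else 0) * ?S (fst p) \<partial>D r)"
      by (rule Bochner_Integration.integral_cong) (auto simp: fZ_def full_data_def)
    also have "\<dots> = (\<integral>w. e (fst w) * ?S w \<partial>B)"
      by (rule D_integral_treated(1)[OF r]) measurable
    \<comment> \<open>Passing from the treated arm to the whole law multiplies the density by
      \<open>weight r / e\<close>, which is the reciprocal of \<open>g\<close>.\<close>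
    also have "\<dots> = (\<integral>w. weight r w * (?S w * g (fst w) (snd (snd w))) \<partial>B)"
    proof (rule integral_cong_AE)
      show "AE w in B. e (fst w) * ?S w = weight r w * (?S w * g (fst w) (snd (snd w)))"
        using AE_B
      proof eventually_elim
        case (elim w)
        have "0 \<le> (1 - e (fst w)) * r (snd (snd w))" using elim r_pos[of "snd (snd w)"] by simp
        then have pos: "0 < weight r w" using elim by (simp add: weight_def)
        have "1 + (1 - e (fst w)) / e (fst w) * r (snd (snd w)) = weight r w / e (fst w)"
          using elim by (simp add: weight_def add_divide_distrib)
        then have "weight r w * g (fst w) (snd (snd w)) = e (fst w)"
          using pos elim by (simp add: g_def)
        then show ?case by (simp add: mult.left_commute mult.commute)
      qed
    qed measurable
    also have "\<dots> = (\<integral>p. ?S (fst p) * g (fst (fst p)) (snd (snd (fst p))) \<partial>D r)"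
      by (rule D_integral[OF r, symmetric]) measurable
    also have "\<dots> = (\<integral>p. ?S (fst p) * ?g (full_data p) \<partial>D r)"
      by (simp add: fX_def fU_def full_data_def latent_def)
    also have "\<dots> = (\<integral>w\<in>A. ?g w \<partial>?Q)"
      by (rule set_eq[OF gfull, symmetric])
    finally show "(\<integral>w\<in>A. ?Z w \<partial>?Q) = (\<integral>w\<in>A. ?g w \<partial>?Q)" .
  qed
  then have lp: "AE w in ?Q. latent_prop ?Q w = ?g w" by (simp add: latent_prop_def)
  have "AE w in ?Q. inverse \<Lambda> \<le> odds (latent_prop ?Q w) / odds (e (fX w)) \<and>
    odds (latent_prop ?Q w) / odds (e (fX w)) \<le> \<Lambda>"
    using lp ov
  proof eventually_elim
    case (elim w)
    have "odds (latent_prop ?Q w) / odds (e (fX w)) = 1 / r (fU w 1)"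
      unfolding elim(1) g_def using elim r_pos by (intro odds_ratio_eq) auto
    then show ?case
      using b[of "fU w 1"] r_pos[of "fU w 1"] Lambda_ge by (simp only:) (simp add: field_simps)
  qed
  ultimately show ?thesis by (simp add: MSM_def)
qed

lemma full_law_in_PI_set:
  assumes r: "unit_weight r" and b: "\<And>v. 1 / \<Lambda> \<le> r v" "\<And>v. r v \<le> \<Lambda>"
  shows "(\<integral>w. weight r w * y1 w \<partial>B) \<in> PI_set P e \<Lambda>"
proof -
  \<comment> \<open>The latent vector has two genuine coordinates, one level for each potential
    outcome, so k = 2 is the dimension of U.\<close>
  have "AE w in full_law r. \<forall>i\<ge>2. fU w i = 0"
  proof (rule AE_full_law)
    have "(\<lambda>w. fU w i) \<in> borel_measurable full_space" for i
      using measurable_compose[OF full_measurable(5)[OF refl] measurable_component_singleton[of i UNIV "\<lambda>_. borel"]] by simp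
    then show "{w \<in> space full_space. \<forall>i\<ge>2. fU w i = 0} \<in> sets full_space" by measurable
    show "AE p in D r. \<forall>i\<ge>2. fU (full_data p) i = 0"
      by (simp add: fU_def full_data_def latent_def)
  qed
  moreover have "(1::nat) \<le> 2" by simp
  ultimately show ?thesis
    unfolding PI_set_def integral_full_law_Y1[OF r, symmetric]
    using compatible_full_law[OF r] MSM_full_law[OF r b] by blast
qed

section \<open>The identified set as an interval\<close>

lemma PI_set_eq: "PI_set P e \<Lambda> = {\<psi> (1 / \<Lambda>)..\<psi> \<Lambda>}" and \<psi>_le: "\<psi> (1 / \<Lambda>) \<le> \<psi> \<Lambda>"
proof -
  have ex: "extremal 1 \<Lambda>" "extremal (-1) (1 / \<Lambda>)" by (auto simp: extremal_def)
  have sub: "PI_set P e \<Lambda> \<subseteq> {\<psi> (1 / \<Lambda>)..\<psi> \<Lambda>}"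
    using PI_upper[OF ex(1)] PI_upper[OF ex(2)] by (auto simp: PI_set_def)
  have pos: "0 < \<Lambda>" "0 < 1 / \<Lambda>" using Lambda_ge by auto
  have tl: "1 / \<Lambda> \<le> two_level L v" "two_level L v \<le> \<Lambda>" if "L = \<Lambda> \<or> L = 1 / \<Lambda>" for L v
    using that inverse_Lambda_le by (auto simp: two_level_def)
  have u: "unit_weight (two_level \<Lambda>)" "unit_weight (two_level (1 / \<Lambda>))"
    using pos by (auto intro!: unit_weight_two_level)
  have iw: "integrable B (\<lambda>w. weight (two_level \<Lambda>) w * y1 w)" "integrable B (\<lambda>w. weight (two_level (1 / \<Lambda>)) w * y1 w)"
    using integrable_weight[OF two_level_measurable two_level_bound] pos integrable_y1 by auto
  have mem: "(1 - s) * \<psi> (1 / \<Lambda>) + s * \<psi> \<Lambda> \<in> PI_set P e \<Lambda>" if s: "0 \<le> s" "s \<le> 1" for s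
  proof -
    let ?r = "\<lambda>v. (1 - s) * two_level (1 / \<Lambda>) v + s * two_level \<Lambda> v"
    have "weight ?r w * y1 w = (1 - s) * (weight (two_level (1 / \<Lambda>)) w * y1 w) + s * (weight (two_level \<Lambda>) w * y1 w)" for w
      by (simp add: weight_def algebra_simps)
    then have "(\<integral>w. weight ?r w * y1 w \<partial>B) = (1 - s) * \<psi> (1 / \<Lambda>) + s * \<psi> \<Lambda>"
      using iw by (simp add: \<psi>_def)
    \<comment> \<open>The lower bound is the convexity bound applied to the negated weights.\<close>
    moreover have "1 / \<Lambda> \<le> ?r v" "?r v \<le> \<Lambda>" for v
      using s tl convex_bound_le[of "two_level (1 / \<Lambda>) v" \<Lambda> "two_level \<Lambda> v" "1 - s" s]
        convex_bound_le[of "- two_level (1 / \<Lambda>) v" "- (1 / \<Lambda>)" "- two_level \<Lambda> v" "1 - s" s] by auto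
    ultimately show ?thesis
      using full_law_in_PI_set[OF unit_weight_convex[OF u(2,1) s]] by simp
  qed
  \<comment> \<open>The order of the endpoints needs no computation: the lower one is realised by a
    full-data law and therefore obeys the upper bound.\<close>
  have "\<psi> (1 / \<Lambda>) \<in> {\<psi> (1 / \<Lambda>)..\<psi> \<Lambda>}" using mem[of 0] sub by auto
  then show le: "\<psi> (1 / \<Lambda>) \<le> \<psi> \<Lambda>" by simp
  have "m \<in> PI_set P e \<Lambda>" if m: "m \<in> {\<psi> (1 / \<Lambda>)..\<psi> \<Lambda>}" for m
  proof -
    obtain s where "0 \<le> s" "s \<le> 1" "m = (1 - s) * \<psi> (1 / \<Lambda>) + s * \<psi> \<Lambda>"
      using m le unfolding closed_segment_eq_real_ivl1[OF le, symmetric]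
      by (auto simp: closed_segment_def)
    then show ?thesis using mem by simp
  qed
  then show "PI_set P e \<Lambda> = {\<psi> (1 / \<Lambda>)..\<psi> \<Lambda>}" using sub by auto
qed

end

theorem theorem1:
  fixes P :: "((real^'d) \<times> real \<times> bool) measure"
    and e :: "real^'d \<Rightarrow> real"
    and F :: "real^'d \<Rightarrow> bool \<Rightarrow> real \<Rightarrow> real"
    and \<Lambda> :: real
  assumes P_prob: "prob_space P"
    and P_sets: "sets P = sets obs_space"
    and e_meas: "e \<in> borel_measurable borel"
    and e_version: "\<forall>A \<in> sets (borel :: (real^'d) measure).
          measure P {(x, y, z) \<in> space P. x \<in> A \<and> z}
            = (\<integral>(x, y, z). indicator A x * e x \<partial>P)"
    and e_overlap: "AE (x, y, z) in P. 0 < e x \<and> e x < 1"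
    and Y_integrable: "integrable P (\<lambda>(x, y, z). y)"
    and F_cdf: "\<forall>x z. is_cdf (F x z)"
    and F_meas: "\<forall>z q. (\<lambda>x. F x z q) \<in> borel_measurable borel"
    and F_version: "\<forall>A \<in> sets (borel :: (real^'d) measure). \<forall>z0 q.
          measure P {(x, y, z) \<in> space P. x \<in> A \<and> z = z0 \<and> y \<le> q}
            = (\<integral>(x, y, z). indicator A x * (if z = z0 then 1 else 0) * F x z0 q \<partial>P)"
    and psi_finite: "integrable P (\<lambda>(x, y, z). y * (if z then 1 else 0) / e x)"
    and Lambda_ge: "\<Lambda> \<ge> 1"
  shows "let \<tau> = \<Lambda> / (\<Lambda> + 1);
             qlo = (\<lambda>(x, y, z). cond_quantile F (1 - \<tau>) x True);
             qhi = (\<lambda>(x, y, z). cond_quantile F \<tau> x True);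
             feas_lo = {Eb \<in> E_infty P e \<Lambda>. wexp P qlo Eb = integral\<^sup>L P qlo};
             feas_hi = {Eb \<in> E_infty P e \<Lambda>. wexp P qhi Eb = integral\<^sup>L P qhi};
             obj = wexp P (\<lambda>(x, y, z). y)
         in \<exists>psi_lo psi_hi. psi_lo \<le> psi_hi \<and> PI_set P e \<Lambda> = {psi_lo..psi_hi} \<and>
              (\<exists>Eb \<in> feas_lo. obj Eb = psi_lo) \<and> (\<forall>Eb \<in> feas_lo. psi_lo \<le> obj Eb) \<and>
              (\<exists>Eb \<in> feas_hi. obj Eb = psi_hi) \<and> (\<forall>Eb \<in> feas_hi. obj Eb \<le> psi_hi)"
proof -
  interpret marginal_sensitivity P e F \<Lambda>
    by (intro marginal_sensitivity.intro observed_law.intro marginal_sensitivity_axioms.intro) fact+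
  let ?\<tau> = "\<Lambda> / (\<Lambda> + 1)"
  \<comment> \<open>The level 1 - \<tau> is L / (L + 1) at L = 1 / \<Lambda>, which brings the lower
    problem into the common family.\<close>
  have lvl: "1 - ?\<tau> = 1 / \<Lambda> / (1 / \<Lambda> + 1)" using Lambda_ge by (simp add: field_simps)
  have qlo: "(\<lambda>(x, y, z). cond_quantile F (1 - ?\<tau>) x True) = (\<lambda>p. q (1 / \<Lambda>) (fst p))"
  proof -
    have "0 < 1 - ?\<tau>" "1 - ?\<tau> < 1" using Lambda_ge by auto
    then show ?thesis unfolding q_def lvl[symmetric] by (simp add: quantile_map_def fun_eq_iff)
  qed
  have qhi: "(\<lambda>(x, y, z). cond_quantile F ?\<tau> x True) = (\<lambda>p. q \<Lambda> (fst p))"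
    using Lambda_ge by (simp add: q_def quantile_map_def fun_eq_iff)
  have y: "(\<lambda>(x, y, z). y) = (\<lambda>p :: (real^'d) \<times> real \<times> bool. fst (snd p))" by auto
  have ex: "extremal 1 \<Lambda>" "extremal (-1) (1 / \<Lambda>)" by (auto simp: extremal_def)
  show ?thesis
    unfolding Let_def qlo qhi y
    using PI_set_eq \<psi>_le wexp_attained[OF ex(1)] wexp_attained[OF ex(2)]
      wexp_upper[OF ex(1)] wexp_upper[OF ex(2)]
    by (intro exI[of _ "\<psi> (1 / \<Lambda>)"] exI[of _ "\<psi> \<Lambda>"]) auto
qed

end
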